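(* Let $\mu=\mathcal N(0,\mathcal C)$ be a centered Gaussian on $\mathbb R^{n_u}\times\mathbb R^{n_v}$ with strictly positive-definite covariance $\mathcal C=\begin{bmatrix}\mathcal C_{uu}&\mathcal C_{uv}\\ \mathcal C_{vu}&\mathcal C_{vv}\end{bmatrix}$, so that the true marginals are $\mu_u=\mathcal N(0,\mathcal C_{uu})$ and $\mu_v=\mathcal N(0,\mathcal C_{vv})$. Consider the model $\nu(du,dv;A)=\frac1Z\exp(\langle u,Av\rangle)\mu_u(du)\mu_v(dv)$, $A\in\mathbb R^{n_u\times n_v}$, and let $\nu_u(du;A)$ be its marginal on $u$. Let $A^\ast_{\mathsf{cond}}$ and $A^\ast_{\mathsf{joint}}$ be the minimizers over $\mathbb R^{n_u\times n_v}$ of the conditional loss $\mathsf L_{\mathsf{cond}}$ and the joint loss $\mathsf L_{\mathsf{joint}}$ defined in the context. Then $$\nu_u(du;A^\ast_{\mathsf{cond}})=\mathcal N\bigl(0,\ \mathcal C_{uu}^{1/2}U(I_{n_u}-\Sigma^2)^{-1}U^\top\mathcal C_{uu}^{1/2}\bigr),$$ $$\nu_u(du;A^\ast_{\mathsf{joint}})=\mathcal N\bigl(0,\ \mathcal C_{uu}^{1/2}U(I_{n_u}-h(\Sigma)^2)^{-1}U^\top\mathcal C_{uu}^{1/2}\bigr),$$ where $U$ and $\Sigma$ are comprised of the left singular vectors and singular values of $\mathcal C_{uu}^{-1/2}\mathcal C_{uv}\mathcal C_{vv}^{-1/2}$. In view of the properties of the function $h$ stated in the context, this shows that minimizing the joint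 loss results in a marginal distribution on $u$ which is closer to the true marginal distribution $\mu_u$ than that obtained by minimizing the conditional loss.
   Context: $h(\sigma)=\sigma^{-1}\bigl(\tfrac12(1+4\sigma^2)^{1/2}-\tfrac12\bigr)$ for $\sigma\in(0,1]$, with $h(0)=0$ by continuity, applied elementwise to the diagonal of $\Sigma$. Properties of $h$: $h(\sigma)\in[0,\sigma)$ for $\sigma\in(0,1]$, $\lim_{\sigma\to0}\sigma^{-1}h(\sigma)=1$, and $h(1)=\tfrac12(\sqrt5-1)\in(0,1)$. Here $U$ is an $n_u\times n_u$ orthogonal matrix and $\Sigma$ an $n_u\times n_u$ diagonal matrix (padded with zeros if $n_u>n_v$). The losses are $$\mathsf L_{\mathsf{cond}}(A)=-\mathbb E_{(u,v)\sim\mu}[\langle u,Av\rangle]+\tfrac12\mathbb E_{u\sim\mu_u}\log\mathbb E_{v\sim\mu_v}[e^{\langle u,Av\rangle}]+\tfrac12\mathbb E_{v\sim\mu_v}\log\mathbb E_{u\sim\mu_u}[e^{\langle u,Av\rangle}],$$ $$\mathsf L_{\mathsf{joint}}(A)=-\mathbb E_{(u,v)\sim\mu}[\langle u,Av\rangle]+\log\mathbb E_{(u,v)\sim\mu_u\otimes\mu_v}[e^{\langle u,Av\rangle}].$$ Square roots of positive-definite matrices are the symmetric positive-definite ones; $Z$ is the normalizing constant. *)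

theory Defs
  imports "HOL-Analysis.Analysis"
begin

section \<open>Matrices\<close>

definition pos_def :: "real^'n^'n \<Rightarrow> bool" where
  "pos_def M \<longleftrightarrow> transpose M = M \<and> (\<forall>x. x \<noteq> 0 \<longrightarrow> x \<bullet> (M *v x) > 0)"

definition mat_sqrt :: "real^'n^'n \<Rightarrow> real^'n^'n" where
  "mat_sqrt M = (THE S. pos_def S \<and> S ** S = M)"

definition block_matrix ::
    "real^'m^'m \<Rightarrow> real^'n^'m \<Rightarrow> real^'m^'n \<Rightarrow> real^'n^'n
      \<Rightarrow> real^('m::finite + 'n::finite)^('m + 'n)" where
  "block_matrix P Q R S = (\<chi> i j. case i of
       Inl a \<Rightarrow> (case j of Inl b \<Rightarrow> P $ a $ b | Inr b \<Rightarrow> Q $ a $ b)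
     | Inr a \<Rightarrow> (case j of Inl b \<Rightarrow> R $ a $ b | Inr b \<Rightarrow> S $ a $ b))"

(* U and the square matrix Sg consist of left singular vectors and singular values of the m x n
   matrix M: M = U Sg W^T. There are CARD('m) left singular vectors, so Sg is m x m; if m > n, at
   most n of its diagonal entries can be nonzero and the others are the zero padding. Only those
   columns of the n x m matrix W that belong to nonzero singular values are right singular
   vectors; the remaining ones do not affect the product, and are unconstrained because m > n
   leaves no room for an orthonormal choice. The singular values need not be sorted. *)
definition left_svd :: "real^'n^'m \<Rightarrow> real^'m^'m \<Rightarrow> real^'m^'m \<Rightarrow> bool" where
  "left_svd M U Sg \<longleftrightarrow>
     orthogonal_matrix U \<and>
     (\<forall>i j. i \<noteq> j \<longrightarrow> Sg $ i $ j = 0) \<and> (\<forall>i. Sg $ i $ i \<ge> 0) \<and>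
     (\<exists>W :: real^'m^'n. M = U ** Sg ** transpose W \<and>
        (\<forall>i j. Sg $ i $ i \<noteq> 0 \<and> Sg $ j $ j \<noteq> 0 \<longrightarrow>
           column i W \<bullet> column j W = (if i = j then 1 else 0)))"

definition h :: "real \<Rightarrow> real" where
  "h s = (if s = 0 then 0 else inverse s * (sqrt (1 + 4 * s\<^sup>2) / 2 - 1 / 2))"

definition h_diag :: "real^'n^'n \<Rightarrow> real^'n^'n" where
  "h_diag Sg = (\<chi> i j. if i = j then h (Sg $ i $ i) else 0)"

section \<open>Measures\<close>

(* Meant for positive definite C only. *)
definition gaussian :: "real^'n^'n \<Rightarrow> (real^'n) measure" where
  "gaussian C = density lborel (\<lambda>x. ennreal
     (exp (- (x \<bullet> (matrix_inv C *v x)) / 2) / sqrt ((2 * pi) ^ CARD('n) * det C)))"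

definition split_vec :: "real^('m::finite + 'n::finite) \<Rightarrow> (real^'m) \<times> (real^'n)" where
  "split_vec x = ((\<chi> i. x $ Inl i), (\<chi> j. x $ Inr j))"

definition gaussian_prod ::
    "real^('m::finite + 'n::finite)^('m + 'n) \<Rightarrow> ((real^'m) \<times> (real^'n)) measure" where
  "gaussian_prod C = distr (gaussian C) borel split_vec"

definition marginal_u :: "((real^'m) \<times> (real^'n)) measure \<Rightarrow> (real^'m) measure" where
  "marginal_u \<mu> = distr \<mu> borel fst"

definition marginal_v :: "((real^'m) \<times> (real^'n)) measure \<Rightarrow> (real^'n) measure" where
  "marginal_v \<mu> = distr \<mu> borel snd"

definition cov_matrix :: "(real^'n) measure \<Rightarrow> real^'n^'n" where
  "cov_matrix M = (\<chi> i j. \<integral>x. (x $ i - (\<integral>y. y $ i \<partial>M)) * (x $ j - (\<integral>y. y $ j \<partial>M)) \<partial>M)"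

section \<open>Model and losses\<close>

(* Z, and the expectation under the logarithm in the joint loss below *)
definition exp_moment :: "((real^'m) \<times> (real^'n)) measure \<Rightarrow> real^'n^'m \<Rightarrow> ennreal" where
  "exp_moment \<mu> A =
     (\<integral>\<^sup>+ (u, v). ennreal (exp (u \<bullet> (A *v v))) \<partial>(marginal_u \<mu> \<Otimes>\<^sub>M marginal_v \<mu>))"

(* A probability measure only if Z is finite; for infinite Z the density vanishes. *)
definition model :: "((real^'m) \<times> (real^'n)) measure \<Rightarrow> real^'n^'m
    \<Rightarrow> ((real^'m) \<times> (real^'n)) measure" where
  "model \<mu> A = density (marginal_u \<mu> \<Otimes>\<^sub>M marginal_v \<mu>)
     (\<lambda>(u, v). ennreal (exp (u \<bullet> (A *v v))) / exp_moment \<mu> A)"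

(* Real-valued: for a Gaussian with positive definite covariance all integrals converge for
   every A, since the inner exponents are linear and the resulting logarithms are quadratic. *)
definition cond_loss :: "((real^'m) \<times> (real^'n)) measure \<Rightarrow> real^'n^'m \<Rightarrow> real" where
  "cond_loss \<mu> A =
     - (\<integral>(u, v). u \<bullet> (A *v v) \<partial>\<mu>)
     + 1 / 2 * (\<integral>u. ln (\<integral>v. exp (u \<bullet> (A *v v)) \<partial>marginal_v \<mu>) \<partial>marginal_u \<mu>)
     + 1 / 2 * (\<integral>v. ln (\<integral>u. exp (u \<bullet> (A *v v)) \<partial>marginal_u \<mu>) \<partial>marginal_v \<mu>)"

definition ext_ln :: "ennreal \<Rightarrow> ereal" where
  "ext_ln x = (if x = \<infinity> then \<infinity> else if x = 0 then -\<infinity> else ereal (ln (enn2real x)))"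

(* Here the exponent is bilinear, so for Gaussian marginals and large A the expectation is
   infinite. Such A have loss +\<infinity>; with the Bochner integral they would get a finite value. *)
definition joint_loss :: "((real^'m) \<times> (real^'n)) measure \<Rightarrow> real^'n^'m \<Rightarrow> ereal" where
  "joint_loss \<mu> A = ereal (- (\<integral>(u, v). u \<bullet> (A *v v) \<partial>\<mu>)) + ext_ln (exp_moment \<mu> A)"

end

(* In whitened coordinates B = Cuu^(1/2) A Cvv^(1/2), the model with parameter A is a centered
   Gaussian whose u-marginal has covariance Cuu^(1/2) (I - B B^T)^(-1) Cuu^(1/2), as one sees by
   completing the square and comparing total masses. The conditional loss is
   |B - M|^2 / 2 up to a constant, with M = Cuu^(-1/2) Cuv Cvv^(-1/2), so it is minimal at B = M.
   The joint loss is that of an exponential family: Z(A) / Z(A0) is the expectation of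
   exp <u, (A - A0) v> under the model with parameter A0, so by Jensen's inequality A0 is the
   unique minimizer as soon as that model has cross-covariance Cuv. For B = U H W^T this moment
   condition reads H / (1 - H^2) = Sigma, which is solved by H = h(Sigma). *)

theory Submission
  imports Defs "HOL-Probability.Distributions"
begin

text \<open>Both minimizers have the form \<open>coupling d\<close>, with \<open>d\<close> equal to
  \<open>\<sigma>\<close> for the conditional loss and to \<open>h\<close> after
  \<open>\<sigma>\<close> for the joint loss, so the model and its u-marginal are computed once for
  all \<open>d\<close> with values in [0, 1). Such a \<open>d\<close> has to vanish where
  \<open>\<sigma>\<close> does, because the columns of \<open>W\<close> at zero singular values are
  arbitrary. That \<open>\<sigma>\<close> < 1, which makes the inverse in the conditional marginal
  meaningful, comes from positive definiteness of the joint covariance and not only of its diagonal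
  blocks. For large parameters the joint loss is infinite; Jensen's inequality is therefore stated
  for integrals with values in [0, \<infinity>], and no loss is ever differentiated. The facts about
  Gaussian measures come from one device: a Gaussian is the image of the standard one under the
  square root of its covariance. Existence of that root rests on an orthonormal eigenbasis, and the
  image formula on the linear change of variables for Lebesgue measure.\<close>

declare transpose_matrix_vector [simp del]

section \<open>Positive definite matrices and their square roots\<close>

lemma inner_matrix_vector_right:
  fixes M :: "real^'n^'m"
  shows "x \<bullet> (M *v y) = (transpose M *v x) \<bullet> y"
  by (simp add: dot_lmul_matrix transpose_matrix_vector)

text \<open>A maximizer of the Rayleigh quotient on the compact unit sphere of \<open>V\<close> is
  an eigenvector. Working in an invariant subspace allows eigenvectors to be split off one at a
  time.\<close>

lemma symmetric_eigenvector_in_subspace: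
  fixes M :: "real^'n^'n"
  assumes sym: "transpose M = M" and V: "subspace V" and inv: "\<And>x. x \<in> V \<Longrightarrow> M *v x \<in> V"
    and nz: "v \<in> V" "v \<noteq> 0"
  obtains x c where "x \<in> V" "norm x = 1" "M *v x = c *\<^sub>R x"
proof -
  let ?S = "V \<inter> sphere 0 1"
  have "compact ?S"
    using closed_subspace[OF V] by (simp add: closed_Int_compact)
  moreover have "v /\<^sub>R norm v \<in> ?S"
    using nz V by (simp add: subspace_scale)
  moreover have "continuous_on ?S (\<lambda>x. x \<bullet> (M *v x))"
    by (intro continuous_intros linear_continuous_on linear_linear[THEN iffD2] matrix_vector_mul_linear)
  ultimately obtain x where x: "x \<in> ?S" and max: "\<And>y. y \<in> ?S \<Longrightarrow> y \<bullet> (M *v y) \<le> x \<bullet> (M *v x)"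
    using continuous_attains_sup[of ?S "\<lambda>x. x \<bullet> (M *v x)"] by blast
  define c where "c = x \<bullet> (M *v x)"
  have nx: "norm x = 1" "x \<in> V" using x by auto
  have le: "y \<bullet> (M *v y) \<le> c * (y \<bullet> y)" if "y \<in> V" for y
  proof (cases "y = 0")
    case False
    have "(y /\<^sub>R norm y) \<bullet> (M *v (y /\<^sub>R norm y)) \<le> c"
      unfolding c_def using that False V by (intro max) (simp add: subspace_scale)
    then have "(y \<bullet> (M *v y)) / (norm y * norm y) \<le> c"
      by (simp add: matrix_vector_mult_scaleR divide_inverse ac_simps)
    then show ?thesis
      using False by (simp add: divide_le_eq flip: power2_norm_eq_inner power2_eq_square)
  qed simp
  \<comment> \<open>The residual of the eigenvalue equation; it lies in \<open>V\<close>, so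
    \<open>x\<close> may be perturbed along it.\<close>
  define w where "w = c *\<^sub>R x - M *v x"
  have wV: "w \<in> V"
    unfolding w_def using nx V inv by (simp add: subspace_diff subspace_scale)
  have xMw: "x \<bullet> (M *v w) = w \<bullet> (M *v x)"
    by (metis sym inner_matrix_vector_right inner_commute)
  have xx: "x \<bullet> x = 1" using nx by (simp add: norm_eq_1)
  have "w \<bullet> w = 0"
  proof (rule ccontr)
    assume "w \<bullet> w \<noteq> 0"
    then have ww: "w \<bullet> w > 0" by simp
    define a where "a = c * (w \<bullet> w) - w \<bullet> (M *v w)"
    have a0: "a \<ge> 0" using le[OF wV] by (simp add: a_def)
    \<comment> \<open>The right-hand side is
      \<open>c * (y \<bullet> y) - y \<bullet> (M *v y)\<close> at
      \<open>y = x + t *\<^sub>R w\<close>. Its linear term has coefficient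
      \<open>2 * (w \<bullet> w)\<close>, so a small negative \<open>t\<close> violates the
      inequality unless \<open>w\<close> vanishes.\<close>
    have key: "0 \<le> 2 * t * (w \<bullet> w) + t\<^sup>2 * a" for t
    proof -
      have "(x + t *\<^sub>R w) \<in> V" using nx wV V by (simp add: subspace_add subspace_scale)
      note le[OF this]
      also have "(x + t *\<^sub>R w) \<bullet> (x + t *\<^sub>R w) = 1 + 2 * t * (w \<bullet> x) + t\<^sup>2 * (w \<bullet> w)"
        by (simp add: inner_add_left inner_add_right xx inner_commute[of x w] power2_eq_square distrib_left)
      also have "(x + t *\<^sub>R w) \<bullet> (M *v (x + t *\<^sub>R w)) =
          x \<bullet> (M *v x) + 2 * t * (w \<bullet> (M *v x)) + t\<^sup>2 * (w \<bullet> (M *v w))"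
        by (simp add: matrix_vector_right_distrib matrix_vector_mult_scaleR inner_add_left
            inner_add_right xMw power2_eq_square distrib_left)
      finally have "x \<bullet> (M *v x) + 2 * t * (w \<bullet> (M *v x)) + t\<^sup>2 * (w \<bullet> (M *v w))
          \<le> c * (1 + 2 * t * (w \<bullet> x) + t\<^sup>2 * (w \<bullet> w))" .
      moreover have "w \<bullet> w = c * (w \<bullet> x) - w \<bullet> (M *v x)"
        by (subst (2) w_def) (simp add: inner_diff_right)
      then have "2 * t * (w \<bullet> w) = 2 * t * (c * (w \<bullet> x)) - 2 * t * (w \<bullet> (M *v x))"
        by (simp only: right_diff_distrib)
      ultimately show ?thesis
        unfolding a_def by (simp add: c_def[symmetric] algebra_simps)
    qed
    \<comment> \<open>The step \<open>t = - p\<close> is small enough for the linear term to win;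
      dividing by \<open>a + 1\<close> instead of \<open>a\<close> covers
      \<open>a = 0\<close>.\<close>
    define p where "p = (w \<bullet> w) / (a + 1)"
    have W: "w \<bullet> w = p * (a + 1)" and p: "p > 0" using a0 ww by (simp_all add: p_def)
    have "0 \<le> 2 * (- p) * (w \<bullet> w) + (- p)\<^sup>2 * a" by (rule key)
    also have "\<dots> = p\<^sup>2 * (- a - 2)"
      unfolding W by (simp add: algebra_simps power2_eq_square)
    also have "\<dots> < 0"
      using a0 p by (intro mult_pos_neg) auto
    finally show False by simp
  qed
  then have "M *v x = c *\<^sub>R x" by (simp add: w_def)
  with nx that show thesis by blast
qed

text \<open>By symmetry the orthogonal complement of a set of eigenvectors is invariant, and it is
  nonzero as long as there are fewer of them than dimensions; it then contains the next
  eigenvector.\<close>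

lemma symmetric_orthonormal_eigenvectors:
  fixes M :: "real^'n^'n"
  assumes sym: "transpose M = M" and "n \<le> CARD('n)"
  shows "\<exists>B. finite B \<and> card B = n \<and> pairwise orthogonal B \<and>
    (\<forall>b\<in>B. norm b = 1 \<and> (\<exists>c. M *v b = c *\<^sub>R b))"
  using assms(2)
proof (induction n)
  case (Suc n)
  then obtain B where B: "finite B" "card B = n" "pairwise orthogonal B"
    "\<And>b. b \<in> B \<Longrightarrow> norm b = 1" "\<And>b. b \<in> B \<Longrightarrow> \<exists>c. M *v b = c *\<^sub>R b"
    by force
  let ?V = "{x. \<forall>b\<in>B. b \<bullet> x = 0}"
  have V: "subspace ?V"
    by (auto simp: subspace_def inner_add_right)
  have "dim (span B) < DIM(real^'n)"
    using Suc.prems B dim_le_card'[of B] by simp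
  then obtain v where v: "v \<noteq> 0" "\<And>y. y \<in> span B \<Longrightarrow> orthogonal v y"
    using orthogonal_to_subspace_exists[of "B"] by (auto simp: dim_span)
  have vV: "v \<in> ?V"
    using v(2) span_base by (fastforce simp: orthogonal_def inner_commute)
  have inv: "M *v x \<in> ?V" if x: "x \<in> ?V" for x
  proof clarsimp
    fix b assume b: "b \<in> B"
    then obtain c where c: "M *v b = c *\<^sub>R b" using B by blast
    have "b \<bullet> (M *v x) = (M *v b) \<bullet> x" using sym by (simp add: inner_matrix_vector_right)
    also have "\<dots> = 0" using c b x by simp
    finally show "b \<bullet> (M *v x) = 0" .
  qed
  obtain x c where x: "x \<in> ?V" "norm x = 1" "M *v x = c *\<^sub>R x"
    using symmetric_eigenvector_in_subspace[OF sym V inv vV v(1)] by blast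
  have "x \<notin> B"
    using x by (auto simp: norm_eq_1)
  then have "card (insert x B) = Suc n" using B by simp
  moreover have "pairwise orthogonal (insert x B)"
    using B x by (auto simp: pairwise_insert orthogonal_def inner_commute)
  ultimately show ?case
    using B x by (intro exI[of _ "insert x B"]) auto
qed (auto intro: exI[of _ "{}"])

lemma symmetric_orthonormal_eigenbasis:
  fixes M :: "real^'n^'n"
  assumes "transpose M = M"
  obtains B c where "finite B" "\<And>b. b \<in> B \<Longrightarrow> norm b = 1" "\<And>x. x = (\<Sum>b\<in>B. (x \<bullet> b) *\<^sub>R b)"
    "\<And>a b. a \<in> B \<Longrightarrow> b \<in> B \<Longrightarrow> a \<bullet> b = (if a = b then 1 else 0)"
    "\<And>b. b \<in> B \<Longrightarrow> M *v b = c b *\<^sub>R b"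
proof -
  from symmetric_orthonormal_eigenvectors[OF assms order_refl]
  obtain B where B: "finite B" "card B = CARD('n)" "pairwise orthogonal B"
    "\<And>b. b \<in> B \<Longrightarrow> norm b = 1" "\<forall>b\<in>B. \<exists>c. M *v b = c *\<^sub>R b"
    by blast
  from B(5) obtain c where c: "\<And>b. b \<in> B \<Longrightarrow> M *v b = c b *\<^sub>R b"
    using bchoice[of B "\<lambda>b c. M *v b = c *\<^sub>R b"] by blast
  have "0 \<notin> B" using B(4)[of 0] by auto
  then have "independent B" using B(3) by (rule pairwise_orthogonal_independent[rotated])
  then have "UNIV \<subseteq> span B"
    using B by (intro card_ge_dim_independent) (auto simp: dim_UNIV)
  then have "x = (\<Sum>b\<in>B. (x \<bullet> b) *\<^sub>R b)" for x
    using orthonormal_basis_expand[of B x] B by (metis UNIV_I subsetD)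
  moreover have "a \<bullet> b = (if a = b then 1 else 0)" if "a \<in> B" "b \<in> B" for a b
    using that B by (auto simp: norm_eq_1 pairwise_def orthogonal_def)
  ultimately show thesis using that B c by blast
qed

lemma pos_def_square_root_exists:
  fixes M :: "real^'n^'n"
  assumes "pos_def M"
  obtains S where "pos_def S" "S ** S = M"
proof -
  have sym: "transpose M = M" using assms by (simp add: pos_def_def)
  obtain B c where B: "finite B" "\<And>b. b \<in> B \<Longrightarrow> norm b = 1" "\<And>x. x = (\<Sum>b\<in>B. (x \<bullet> b) *\<^sub>R b)"
    "\<And>a b. a \<in> B \<Longrightarrow> b \<in> B \<Longrightarrow> a \<bullet> b = (if a = b then 1 else 0)"
    "\<And>b. b \<in> B \<Longrightarrow> M *v b = c b *\<^sub>R b"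
    using symmetric_orthonormal_eigenbasis[OF sym] by blast
  have c: "c b > 0" if "b \<in> B" for b
  proof -
    have "b \<noteq> 0" using B(2)[OF that] by auto
    then have "0 < b \<bullet> (M *v b)" using assms by (simp add: pos_def_def)
    then show ?thesis using B(4,5) that by simp
  qed
  \<comment> \<open>The operator with the eigenvectors of \<open>M\<close> and the square roots of
    its eigenvalues.\<close>
  define f where "f x = (\<Sum>b\<in>B. (sqrt (c b) * (x \<bullet> b)) *\<^sub>R b)" for x
  have "linear f"
    unfolding f_def by (rule linearI) (simp_all add: inner_add_left algebra_simps sum.distrib scaleR_sum_right)
  define S where "S = matrix f"
  have S: "S *v x = f x" for x
    unfolding S_def using \<open>linear f\<close> by (simp add: matrix_works)
  have fb: "f x \<bullet> b = sqrt (c b) * (x \<bullet> b)" if "b \<in> B" for b x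
  proof -
    have "f x \<bullet> b = (\<Sum>a\<in>B. if a = b then sqrt (c b) * (x \<bullet> b) else 0)"
      unfolding f_def inner_sum_left using that B(4) by (intro sum.cong) auto
    then show ?thesis using that B(1) by simp
  qed
  have ip: "x \<bullet> f y = (\<Sum>b\<in>B. sqrt (c b) * (x \<bullet> b) * (y \<bullet> b))" for x y
    unfolding f_def by (simp add: inner_sum_right ac_simps)
  have "S *v (S *v x) = M *v x" for x
  proof -
    have "S *v (S *v x) = (\<Sum>b\<in>B. (x \<bullet> b) *\<^sub>R (M *v b))"
    proof -
      have "sqrt (c b) * (f x \<bullet> b) = (x \<bullet> b) * c b" if "b \<in> B" for b
        using c[OF that] by (simp add: fb[OF that] flip: mult.assoc)
      then show ?thesis
        unfolding S by (subst f_def) (simp add: B(5) cong: sum.cong)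
    qed
    also have "\<dots> = M *v (\<Sum>b\<in>B. (x \<bullet> b) *\<^sub>R b)"
      by (simp add: linear_sum[OF matrix_vector_mul_linear] matrix_vector_mult_scaleR)
    also have "\<dots> = M *v x" using B(3)[of x] by simp
    finally show ?thesis .
  qed
  then have SS: "S ** S = M"
    by (simp add: matrix_eq matrix_vector_mul_assoc)
  have "(transpose S *v x) \<bullet> y = (S *v x) \<bullet> y" for x y
    by (subst inner_matrix_vector_right[symmetric]) (simp add: S ip inner_commute[of "f x"] ac_simps)
  then have "transpose S = S"
    by (simp add: matrix_eq) (metis vector_eq_rdot)
  moreover have "x \<bullet> (S *v x) > 0" if "x \<noteq> 0" for x
  proof -
    have "\<exists>b\<in>B. x \<bullet> b \<noteq> 0"
      using B(3)[of x] that by (metis (no_types, lifting) scaleR_zero_left sum.neutral)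
    then have "0 < (\<Sum>b\<in>B. sqrt (c b) * (x \<bullet> b)\<^sup>2)"
      using c B(1) by (auto intro!: sum_pos2 simp: less_imp_le)
    then show ?thesis by (simp add: S ip mult.assoc power2_eq_square)
  qed
  ultimately have "pos_def S" by (simp add: pos_def_def)
  then show thesis using SS that by blast
qed

section \<open>Algebra of rectangular matrices and uniqueness of the square root\<close>

lemma matrix_add_rdistrib: "(A + B) ** C = A ** C + B ** (C :: 'a::semiring_1^'p^'n)"
  by (simp add: vec_eq_iff matrix_matrix_mult_def sum.distrib ring_distribs)

lemma matrix_diff_ldistrib: "A ** (B - C) = A ** B - A ** (C :: 'a::ring_1^'p^'n)"
  by (simp add: vec_eq_iff matrix_matrix_mult_def sum_subtractf right_diff_distrib)

lemma matrix_diff_rdistrib: "(A - B) ** C = A ** C - B ** (C :: 'a::ring_1^'p^'n)"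
  by (simp add: vec_eq_iff matrix_matrix_mult_def sum_subtractf left_diff_distrib)

lemma matrix_minus_left: "(- A) ** C = - (A ** (C :: 'a::ring_1^'p^'n))"
  by (simp add: vec_eq_iff matrix_matrix_mult_def sum_negf)

lemma matrix_minus_right: "A ** (- C) = - (A ** (C :: 'a::ring_1^'p^'n))"
  by (simp add: vec_eq_iff matrix_matrix_mult_def sum_negf)

lemma matrix_vector_minus_left: "(- A) *v x = - (A *v (x :: 'a::ring_1^'n))"
  by (simp add: vec_eq_iff matrix_vector_mult_def sum_negf)

lemma matrix_vector_minus_right: "A *v (- x) = - (A *v (x :: 'a::ring_1^'n))"
  by (simp add: vec_eq_iff matrix_vector_mult_def sum_negf)

lemma transpose_minus: "transpose (- A) = - transpose (A :: 'a::ring_1^'n^'m)"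
  by (simp add: vec_eq_iff transpose_def)

lemma transpose_diff: "transpose (A - B) = transpose A - transpose (B :: 'a::ring_1^'n^'m)"
  by (simp add: vec_eq_iff transpose_def)

text \<open>For \<open>D = S - T\<close> we have \<open>S D + D T = S\<^sup>2 - T\<^sup>2 = 0\<close>, hence \<open>D S D\<close> and \<open>D T D\<close> are
  positive semidefinite matrices whose traces add up to zero.\<close>

lemma pos_def_square_root_unique:
  fixes S T :: "real^'n^'n"
  assumes S: "pos_def S" and T: "pos_def T" and eq: "S ** S = T ** T"
  shows "S = T"
proof -
  define D where "D = S - T"
  have symS: "transpose S = S" and symT: "transpose T = T" using S T by (auto simp: pos_def_def)
  have symD: "transpose D = D" by (simp add: D_def transpose_diff symS symT)
  have "S ** D + D ** T = 0"
    unfolding D_def using eq by (simp add: matrix_diff_ldistrib matrix_diff_rdistrib)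
  then have "trace (D ** (S ** D)) + trace (D ** (D ** T)) = 0"
    
    by (metis matrix_add_ldistrib mat_0 times0_right trace_0 trace_add)
  moreover have "trace (D ** (D ** T)) = trace (D ** (T ** D))"
    by (metis matrix_mul_assoc trace_mul_sym)
  moreover have tr: "trace (D ** (Q ** D)) = (\<Sum>i\<in>UNIV. column i D \<bullet> (Q *v column i D))" for Q
  proof -
    have "(D ** (Q ** D)) $ i $ i = column i D \<bullet> (Q *v column i D)" for i
    proof -
      have "(D ** (Q ** D)) $ i $ i = row i D \<bullet> column i (Q ** D)"
        by (simp add: matrix_matrix_mult_def row_def column_def inner_vec_def)
      also have "row i D = column i D" by (metis row_transpose symD)
      also have "column i (Q ** D) = Q *v column i D"
        by (simp add: vec_eq_iff matrix_matrix_mult_def column_def matrix_vector_mult_def)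
      finally show ?thesis .
    qed
    then show ?thesis by (simp add: trace_def)
  qed
  moreover have nn: "x \<bullet> (S *v x) \<ge> 0" "x \<bullet> (T *v x) \<ge> 0" for x
    using S T by (cases "x = 0"; auto simp: pos_def_def less_imp_le)+
  ultimately have "(\<Sum>i\<in>UNIV. column i D \<bullet> (S *v column i D)) = 0"
    using sum_nonneg[of UNIV "\<lambda>i. column i D \<bullet> (S *v column i D)"]
      sum_nonneg[of UNIV "\<lambda>i. column i D \<bullet> (T *v column i D)"] by simp
  then have "column i D \<bullet> (S *v column i D) = 0" for i
    using nn by (simp add: sum_nonneg_eq_0_iff)
  then have "column i D = 0" for i
    using S by (metis less_irrefl pos_def_def)
  then have "D = 0"
    by (simp add: vec_eq_iff column_def)
  then show ?thesis by (simp add: D_def)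
qed

lemma mat_sqrt:
  assumes "pos_def M"
  shows pos_def_mat_sqrt: "pos_def (mat_sqrt M)" and mat_sqrt_mult_self: "mat_sqrt M ** mat_sqrt M = M"
proof -
  obtain S where S: "pos_def S \<and> S ** S = M"
    using pos_def_square_root_exists[OF assms] by blast
  have "pos_def (mat_sqrt M) \<and> mat_sqrt M ** mat_sqrt M = M"
    unfolding mat_sqrt_def
    by (rule theI[of _ S], rule S) (use S in \<open>auto intro: pos_def_square_root_unique\<close>)
  then show "pos_def (mat_sqrt M)" "mat_sqrt M ** mat_sqrt M = M" by auto
qed

section \<open>Inverses, determinants and congruences of positive definite matrices\<close>

lemma pos_def_sym: "pos_def M \<Longrightarrow> transpose M = M"
  by (simp add: pos_def_def)

lemma pos_def_nonneg: "pos_def M \<Longrightarrow> 0 \<le> x \<bullet> (M *v x)"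
  by (cases "x = 0") (auto simp: pos_def_def less_imp_le)

lemma pos_def_invertible:
  fixes M :: "real^'n^'n"
  assumes "pos_def M"
  shows "invertible M"
proof -
  have "x = 0" if "M *v x = 0" for x
    using assms that by (metis inner_zero_right less_irrefl pos_def_def)
  then show ?thesis
    using matrix_left_invertible_ker invertible_left_inverse by metis
qed

lemma matrix_inv_mult:
  assumes "invertible A"
  shows matrix_inv_right: "A ** matrix_inv A = mat 1" and matrix_inv_left: "matrix_inv A ** A = mat 1"
  using someI_ex[OF assms[unfolded invertible_def]] by (auto simp: matrix_inv_def)

lemma matrix_inv_eqI:
  fixes A B :: "real^'n^'n"
  assumes "A ** B = mat 1"
  shows "matrix_inv A = B"
  by (metis assms invertible_right_inverse matrix_inv_left matrix_mul_assoc matrix_mul_lid matrix_mul_rid)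

lemma pos_def_matrix_inv:
  assumes M: "pos_def M"
  shows "pos_def (matrix_inv M)"
proof -
  note inv = matrix_inv_mult[OF pos_def_invertible[OF M]]
  have "transpose (matrix_inv M) ** M = mat 1"
    using inv(1) pos_def_sym[OF M] by (metis matrix_transpose_mul transpose_mat)
  then have "transpose (matrix_inv M) = matrix_inv M"
    by (metis inv(1) matrix_mul_assoc matrix_mul_lid matrix_mul_rid)
  moreover have "x \<bullet> (matrix_inv M *v x) > 0" if "x \<noteq> 0" for x
  proof -
    have x: "x = M *v (matrix_inv M *v x)"
      using inv by (simp add: matrix_vector_mul_assoc)
    then have "matrix_inv M *v x \<noteq> 0" using that by auto
    then have "0 < (matrix_inv M *v x) \<bullet> (M *v (matrix_inv M *v x))"
      using M by (simp add: pos_def_def)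
    then show ?thesis using x by (simp add: inner_commute)
  qed
  ultimately show ?thesis by (simp add: pos_def_def)
qed

lemma matrix_inv_matrix_inv:
  fixes M :: "real^'n^'n"
  assumes "invertible M"
  shows "matrix_inv (matrix_inv M) = M"
  by (rule matrix_inv_eqI) (rule matrix_inv_left[OF assms])

lemma det_pos_def:
  assumes "pos_def M"
  shows "det M > 0"
proof -
  have "det (mat_sqrt M) \<noteq> 0"
    using pos_def_mat_sqrt[OF assms] pos_def_invertible invertible_det_nz by blast
  then show ?thesis
    by (metis assms det_mul mat_sqrt_mult_self not_real_square_gt_zero)
qed

lemma pos_def_congruence:
  fixes M A :: "real^'n^'n"
  assumes "pos_def M" "invertible A"
  shows "pos_def (A ** M ** transpose A)"
proof -
  have "x \<bullet> ((A ** M ** transpose A) *v x) > 0" if "x \<noteq> 0" for x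
  proof -
    have "transpose A *v x \<noteq> 0"
      using that assms(2)
      by (metis matrix_inv_mult(2) matrix_vector_mul_assoc matrix_vector_mul_lid matrix_vector_mult_0_right transpose_invertible)
    then show ?thesis
      using assms(1) by (simp add: pos_def_def inner_matrix_vector_right[of _ A] flip: matrix_vector_mul_assoc)
  qed
  then show ?thesis
    using pos_def_sym[OF assms(1)] by (simp add: pos_def_def matrix_transpose_mul matrix_mul_assoc)
qed

lemma pos_def_mat_1: "pos_def (mat 1)"
  by (simp add: pos_def_def)

section \<open>Linear changes of variables for Lebesgue measure\<close>

lemma borel_measurable_linear:
  fixes f :: "'a::euclidean_space \<Rightarrow> 'b::euclidean_space"
  assumes "linear f"
  shows "f \<in> borel_measurable borel"
  using assms by (intro borel_measurable_continuous_onI linear_continuous_on linear_linear[THEN iffD2])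

lemma borel_measurable_matrix_vector [measurable (raw)]:
  fixes A :: "real^'n^'m"
  assumes [measurable]: "f \<in> borel_measurable M"
  shows "(\<lambda>x. A *v f x) \<in> borel_measurable M"
  by (rule measurable_compose[OF assms borel_measurable_linear[OF matrix_vector_mul_linear]])

lemma Basis_vec_eq: "(Basis :: (real^'n) set) = range (\<lambda>i. axis i 1)"
  by (auto simp: Basis_vec_def)

lemma sum_mult_delta:
  fixes f :: "'n::finite \<Rightarrow> 'a::semiring_1"
  shows "(\<Sum>j\<in>UNIV. f j * (if i = j then 1 else 0)) = f i"
proof -
  have "(\<Sum>j\<in>UNIV. f j * (if i = j then 1 else 0)) = (\<Sum>j\<in>UNIV. if i = j then f j else 0)"
    by (intro sum.cong) auto
  then show ?thesis by simp
qed

lemma axis_1_nth: "axis j 1 $ i = (if i = j then 1 else 0)"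
  by (simp add: axis_def)

lemma prod_Basis_vec: "(\<Prod>b\<in>(Basis :: (real^'n) set). f b) = (\<Prod>i\<in>UNIV. f (axis i 1))"
  unfolding Basis_vec_eq by (subst prod.reindex) (auto simp: inj_on_def axis_eq_axis)

lemma sum_Basis_vec: "(\<Sum>b\<in>(Basis :: (real^'n) set). f b) = (\<Sum>i\<in>UNIV. f (axis i 1))"
  unfolding Basis_vec_eq by (subst sum.reindex) (auto simp: inj_on_def axis_eq_axis)

lemma nn_integral_lborel_translation:
  fixes c :: "'a::euclidean_space"
  assumes [measurable]: "g \<in> borel_measurable borel"
  shows "(\<integral>\<^sup>+x. g (c + x) \<partial>lborel) = (\<integral>\<^sup>+x. g x \<partial>lborel)"
  by (subst lborel_distr_plus[symmetric, of c]) (simp add: nn_integral_distr)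

lemma nn_integral_lborel_scale:
  fixes c :: "'n::finite \<Rightarrow> real" and g :: "real^'n \<Rightarrow> ennreal"
  assumes c: "\<And>i. c i \<noteq> 0" and [measurable]: "g \<in> borel_measurable borel"
  shows "(\<integral>\<^sup>+x. g x \<partial>lborel) = ennreal \<bar>\<Prod>i\<in>UNIV. c i\<bar> * (\<integral>\<^sup>+x. g (\<chi> i. c i * x $ i) \<partial>lborel)"
proof -
  define c' where "c' b = (\<Sum>i\<in>UNIV. c i * b $ i)" for b :: "real^'n"
  have c': "c' (axis i 1) = c i" for i
  proof -
    have "c' (axis i 1) = (\<Sum>j\<in>UNIV. if j = i then c i else 0)"
      unfolding c'_def by (intro sum.cong) (auto simp: axis_def)
    then show ?thesis by simp
  qed
  \<comment> \<open>The summand 0 is the translation part in \<open>lborel_affine_euclidean\<close>,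
    kept so that the rule applies literally.\<close>
  define T where "T x = 0 + (\<Sum>j\<in>Basis. (c' j * (x \<bullet> j)) *\<^sub>R j)" for x :: "real^'n"
  have T: "T x = (\<chi> i. c i * x $ i)" for x
  proof -
    have "T x $ i = c i * x $ i" for i
      unfolding T_def sum_Basis_vec by (simp add: c' inner_axis axis_1_nth sum_mult_delta)
    then show ?thesis by (simp add: vec_eq_iff)
  qed
  have [measurable]: "T \<in> borel \<rightarrow>\<^sub>M borel"
    by (simp add: T_def[abs_def])
  have nz: "c' j \<noteq> 0" if "j \<in> Basis" for j
    using that c c' by (auto simp: Basis_vec_eq)
  have "lborel = density (distr lborel borel T) (\<lambda>_. ennreal (\<Prod>j\<in>Basis. \<bar>c' j\<bar>))"
    unfolding T_def[abs_def] by (rule lborel_affine_euclidean) (use nz in auto)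
  then have "(\<integral>\<^sup>+x. g x \<partial>lborel) = (\<integral>\<^sup>+x. g x \<partial>density (distr lborel borel T) (\<lambda>_. ennreal (\<Prod>j\<in>Basis. \<bar>c' j\<bar>)))"
    by simp
  also have "\<dots> = ennreal \<bar>\<Prod>i\<in>UNIV. c i\<bar> * (\<integral>\<^sup>+x. g (T x) \<partial>lborel)"
    by (simp add: nn_integral_density nn_integral_distr nn_integral_cmult prod_Basis_vec c' abs_prod)
  finally show ?thesis by (simp add: T)
qed

text \<open>Swapping coordinates maps boxes to boxes and permutes their side lengths; Lebesgue
  measure is determined by its values on boxes.\<close>

lemma nn_integral_lborel_transpose:
  fixes g :: "real^'n \<Rightarrow> ennreal"
  assumes [measurable]: "g \<in> borel_measurable borel"
  shows "(\<integral>\<^sup>+x. g (\<chi> i. x $ Transposition.transpose m n i) \<partial>lborel) = (\<integral>\<^sup>+x. g x \<partial>lborel)"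
proof -
  define T where "T x = (\<chi> i. x $ Transposition.transpose m n i)" for x :: "real^'n"
  have "linear T" by (rule linearI) (auto simp: T_def vec_eq_iff)
  then have [measurable]: "T \<in> borel \<rightarrow>\<^sub>M borel" by (rule borel_measurable_linear)
  have "lborel = distr lborel borel T"
  proof (rule lborel_eqI)
    fix l u :: "real^'n" assume lu: "\<And>b. b \<in> Basis \<Longrightarrow> l \<bullet> b \<le> u \<bullet> b"
    have le: "l $ i \<le> u $ i" for i using lu[of "axis i 1"] by (simp add: inner_axis)
    have "T -` box l u = box (T l) (T u)"
    proof -
      have "(\<forall>i. l $ i < x $ Transposition.transpose m n i \<and> x $ Transposition.transpose m n i < u $ i) \<longleftrightarrow>
          (\<forall>i. l $ Transposition.transpose m n i < x $ i \<and> x $ i < u $ Transposition.transpose m n i)" for x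
        by (metis transpose_involutory)
      then show ?thesis
        by (simp add: set_eq_iff mem_box_cart T_def)
    qed
    then have "emeasure (distr lborel borel T) (box l u) = emeasure lborel (box (T l) (T u))"
      by (simp add: emeasure_distr)
    also have "\<dots> = (\<Prod>i\<in>UNIV. (T u - T l) $ i)"
    proof -
      have "\<forall>b\<in>Basis. T l \<bullet> b \<le> T u \<bullet> b"
        using le by (simp add: Basis_vec_eq inner_axis T_def)
      then show ?thesis
        by (simp only: emeasure_lborel_box_eq prod_Basis_vec inner_axis if_True) simp
    qed
    also have "(\<Prod>i\<in>UNIV. (T u - T l) $ i) = (\<Prod>i\<in>UNIV. (u - l) $ i)"
      unfolding T_def
      by (rule prod.reindex_bij_witness[of _ "Transposition.transpose m n" "Transposition.transpose m n"]) auto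
    finally show "emeasure (distr lborel borel T) (box l u) = (\<Prod>b\<in>Basis. (u - l) \<bullet> b)"
      by (simp add: prod_Basis_vec inner_axis)
  qed simp
  then have "(\<integral>\<^sup>+x. g x \<partial>lborel) = (\<integral>\<^sup>+x. g x \<partial>distr lborel borel T)" by simp
  then show ?thesis by (simp add: nn_integral_distr T_def)
qed

text \<open>Integrate over coordinate \<open>m\<close> first: with the other coordinates fixed, the
  shear is a translation by the constant value of coordinate \<open>n\<close>.\<close>

lemma nn_integral_lborel_shear:
  fixes g :: "real^'n \<Rightarrow> ennreal"
  assumes mn: "m \<noteq> n" and [measurable]: "g \<in> borel_measurable borel"
  shows "(\<integral>\<^sup>+x. g (\<chi> i. if i = m then x $ m + x $ n else x $ i) \<partial>lborel) = (\<integral>\<^sup>+x. g x \<partial>lborel)"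
proof -
  interpret product_sigma_finite "\<lambda>_::real^'n. lborel :: real measure" ..
  define T where "T x = (\<chi> i. if i = m then x $ m + x $ n else x $ i)" for x :: "real^'n"
  have "linear T" by (rule linearI) (auto simp: T_def vec_eq_iff algebra_simps)
  then have [measurable]: "T \<in> borel \<rightarrow>\<^sub>M borel" by (rule borel_measurable_linear)
  define e where "e i = (axis i 1 :: real^'n)" for i
  define B where "B = Basis - {e m}"
  have B: "finite B" "e m \<notin> B" "Basis = insert (e m) B" "e n \<in> B"
    using mn by (auto simp: B_def e_def Basis_vec_eq axis_eq_axis)
  \<comment> \<open>\<open>F\<close> assembles a vector from its coordinates, indexed by basis
    vectors; singling out \<open>e m\<close> in the index set is what
    \<open>product_nn_integral_insert\<close> asks for.\<close>
  define F where "F \<phi> = (\<Sum>b\<in>insert (e m) B. \<phi> b *\<^sub>R b)" for \<phi> :: "real^'n \<Rightarrow> real"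
  have F [measurable]: "F \<in> borel_measurable (Pi\<^sub>M (insert (e m) B) (\<lambda>_. lborel))"
    unfolding F_def by measurable
  have int: "(\<integral>\<^sup>+x. k x \<partial>lborel) = (\<integral>\<^sup>+\<phi>. (\<integral>\<^sup>+y. k (F (\<phi>(e m := y))) \<partial>lborel) \<partial>Pi\<^sub>M B (\<lambda>_. lborel))"
    if [measurable]: "k \<in> borel_measurable borel" for k :: "real^'n \<Rightarrow> ennreal"
  proof -
    have "lborel = distr (Pi\<^sub>M (insert (e m) B) (\<lambda>_. lborel)) borel F"
      unfolding F_def B(3)[symmetric] by (rule lborel_eq)
    then have "(\<integral>\<^sup>+x. k x \<partial>lborel) = (\<integral>\<^sup>+\<phi>. k (F \<phi>) \<partial>Pi\<^sub>M (insert (e m) B) (\<lambda>_. lborel))"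
      by (rule ssubst[where P="\<lambda>M. integral\<^sup>N M k = _"]) (simp add: nn_integral_distr)
    also have "\<dots> = (\<integral>\<^sup>+\<phi>. (\<integral>\<^sup>+y. k (F (\<phi>(e m := y))) \<partial>lborel) \<partial>Pi\<^sub>M B (\<lambda>_. lborel))"
      by (rule product_nn_integral_insert) (use B(1,2) in auto)
    finally show ?thesis .
  qed
  have F_nth: "F \<phi> $ i = \<phi> (e i)" for \<phi> i
  proof -
    show ?thesis
      unfolding F_def B(3)[symmetric] sum_Basis_vec by (simp add: e_def axis_1_nth sum_mult_delta)
  qed
  have TF: "T (F (\<phi>(e m := y))) = F (\<phi>(e m := \<phi> (e n) + y))" for \<phi> y
  proof -
    have "e i = e j \<longleftrightarrow> i = j" for i j by (simp add: e_def axis_eq_axis)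
    with mn show ?thesis by (simp add: vec_eq_iff F_nth T_def)
  qed
  have "(\<integral>\<^sup>+x. g (T x) \<partial>lborel) = (\<integral>\<^sup>+\<phi>. (\<integral>\<^sup>+y. g (F (\<phi>(e m := \<phi> (e n) + y))) \<partial>lborel) \<partial>Pi\<^sub>M B (\<lambda>_. lborel))"
    by (subst int) (simp_all add: TF)
  also have "\<dots> = (\<integral>\<^sup>+\<phi>. (\<integral>\<^sup>+y. g (F (\<phi>(e m := y))) \<partial>lborel) \<partial>Pi\<^sub>M B (\<lambda>_. lborel))"
  proof (rule nn_integral_cong)
    fix \<phi> assume \<phi>: "\<phi> \<in> space (Pi\<^sub>M B (\<lambda>_. lborel :: real measure))"
    have "(\<lambda>y. F (\<phi>(e m := y))) \<in> borel_measurable borel"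
    proof -
      have eq: "F (\<phi>(e m := y)) = (\<Sum>b\<in>B. \<phi> b *\<^sub>R b) + y *\<^sub>R e m" for y
      proof -
        have "(\<Sum>b\<in>B. (if b = e m then y else \<phi> b) *\<^sub>R b) = (\<Sum>b\<in>B. \<phi> b *\<^sub>R b)"
          using B(2) by (intro sum.cong) auto
        then show ?thesis
          using B(1,2) by (simp add: F_def)
      qed
      show ?thesis unfolding eq by measurable
    qed
    then have [measurable]: "(\<lambda>y. g (F (\<phi>(e m := y)))) \<in> borel_measurable borel"
      by measurable
    show "(\<integral>\<^sup>+y. g (F (\<phi>(e m := \<phi> (e n) + y))) \<partial>lborel) = (\<integral>\<^sup>+y. g (F (\<phi>(e m := y))) \<partial>lborel)"
      by (rule nn_integral_lborel_translation[of "\<lambda>y. g (F (\<phi>(e m := y)))"]) measurable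
  qed
  also have "\<dots> = (\<integral>\<^sup>+x. g x \<partial>lborel)"
    by (rule int[symmetric]) measurable
  finally show ?thesis by (simp add: T_def)
qed

text \<open>Induction over elementary linear maps. The claim carries its own assumption on the
  determinant and ranges over all \<open>g\<close>: for a composition the determinant factors and
  the inner map is applied to \<open>g\<close> precomposed with the outer map, while for a map with
  a zero coordinate the claim is vacuous.\<close>

lemma nn_integral_lborel_linear:
  fixes f :: "real^'n \<Rightarrow> real^'n"
  assumes "linear f" "det (matrix f) \<noteq> 0" "g \<in> borel_measurable borel"
  shows "(\<integral>\<^sup>+x. g x \<partial>lborel) = ennreal \<bar>det (matrix f)\<bar> * (\<integral>\<^sup>+x. g (f x) \<partial>lborel)"
proof -
  have "det (matrix f) \<noteq> 0 \<longrightarrow> (\<forall>g\<in>borel_measurable borel.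
    (\<integral>\<^sup>+x. g x \<partial>lborel) = ennreal \<bar>det (matrix f)\<bar> * (\<integral>\<^sup>+x. g (f x) \<partial>lborel))"
    using \<open>linear f\<close>
  proof (induction f rule: induct_linear_elementary[consumes 1, case_names comp zeroes const swap idplus])
    case (comp f h)
    show ?case
    proof (intro impI ballI)
      fix g :: "real^'n \<Rightarrow> ennreal"
      assume g [measurable]: "g \<in> borel_measurable borel" and "det (matrix (f \<circ> h)) \<noteq> 0"
      then have d: "det (matrix f) \<noteq> 0" "det (matrix h) \<noteq> 0"
        and de: "\<bar>det (matrix (f \<circ> h))\<bar> = \<bar>det (matrix f)\<bar> * \<bar>det (matrix h)\<bar>"
        by (auto simp: matrix_compose[OF comp(2,1)] det_mul abs_mult)
      have [measurable]: "f \<in> borel_measurable borel" by (rule borel_measurable_linear[OF comp(1)])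
      have "(\<integral>\<^sup>+x. g x \<partial>lborel) = ennreal \<bar>det (matrix f)\<bar> * (\<integral>\<^sup>+x. g (f x) \<partial>lborel)"
        using comp(3) d g by blast
      also have "(\<integral>\<^sup>+x. g (f x) \<partial>lborel) = ennreal \<bar>det (matrix h)\<bar> * (\<integral>\<^sup>+x. g (f (h x)) \<partial>lborel)"
        using comp(4) d by (intro comp(4)[rule_format]) auto
      finally show "(\<integral>\<^sup>+x. g x \<partial>lborel) =
          ennreal \<bar>det (matrix (f \<circ> h))\<bar> * (\<integral>\<^sup>+x. g ((f \<circ> h) x) \<partial>lborel)"
        by (simp add: de ennreal_mult mult.assoc)
    qed
  next
    case (zeroes f i)
    then have "row i (matrix f) = 0"
      by (simp add: row_def matrix_def vec_eq_iff)
    then show ?case by (simp add: det_zero_row)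
  next
    case (const c)
    have "det (matrix (\<lambda>x. \<chi> i. c i * x $ i)) = (\<Prod>i\<in>UNIV. c i)"
      by (subst det_diagonal) (auto simp: matrix_def axis_def)
    then show ?case
      using nn_integral_lborel_scale[of c] by auto
  next
    case (swap m n)
    let ?T = "\<lambda>x::real^'n. \<chi> i. x $ Transposition.transpose m n i"
    have lin: "linear ?T" by (rule linearI) (auto simp: vec_eq_iff)
    \<comment> \<open>Only the absolute value of the determinant matters, and for an involution it
      is 1.\<close>
    have "?T \<circ> ?T = id" by (auto simp: fun_eq_iff vec_eq_iff)
    then have "det (matrix ?T) * det (matrix ?T) = 1"
      by (metis det_I det_mul lin matrix_compose matrix_id_mat_1)
    then have "\<bar>det (matrix ?T)\<bar> = 1"
      by (auto simp: power2_eq_1_iff simp flip: power2_eq_square)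
    then show ?case
      using nn_integral_lborel_transpose[of _ m n] by auto
  next
    case (idplus m n)
    \<comment> \<open>The shear is the identity matrix with row \<open>n\<close> added to row
      \<open>m\<close>, which leaves the determinant at 1.\<close>
    have "matrix (\<lambda>x::real^'n. \<chi> i. if i = m then x $ m + x $ n else x $ i) =
        (\<chi> k. if k = m then row m (mat 1) + 1 *s row n (mat 1) else row k (mat 1))"
      using idplus by (auto simp: vec_eq_iff matrix_def axis_def row_def mat_def)
    then have "det (matrix (\<lambda>x::real^'n. \<chi> i. if i = m then x $ m + x $ n else x $ i)) = 1"
      using det_row_operation[OF idplus, where A = "mat 1 :: real^'n^'n" and c = 1] by simp
    then show ?case
      using nn_integral_lborel_shear[OF idplus] by auto
  qed
  with assms show ?thesis by blast
qed

lemma nn_integral_lborel_matrix: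
  fixes A :: "real^'n^'n"
  assumes "invertible A" "g \<in> borel_measurable borel"
  shows "(\<integral>\<^sup>+x. g x \<partial>lborel) = ennreal \<bar>det A\<bar> * (\<integral>\<^sup>+x. g (A *v x) \<partial>lborel)"
  using nn_integral_lborel_linear[OF matrix_vector_mul_linear[of A] _ assms(2)] assms(1)
  by (simp add: invertible_det_nz)

section \<open>Gaussian measures\<close>

lemma sets_gaussian [measurable_cong, simp]: "sets (gaussian C) = sets borel"
  by (simp add: gaussian_def)

lemma space_gaussian [simp]: "space (gaussian C) = UNIV"
  by (simp add: gaussian_def)

lemma matrix_inv_mat_1: "matrix_inv (mat 1) = (mat 1 :: real^'n^'n)"
  by (rule matrix_inv_eqI) simp

text \<open>Factoring the density over coordinates reduces mass and second moments to the
  one-dimensional normal distribution.\<close>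

lemma gaussian_mat_1:
  "gaussian (mat 1 :: real^'n^'n) =
    density lborel (\<lambda>x. \<Prod>b\<in>Basis. ennreal (std_normal_density (x \<bullet> b)))"
proof -
  have "exp (- (x \<bullet> x) / 2) / sqrt ((2 * pi) ^ CARD('n)) = (\<Prod>b\<in>Basis. std_normal_density (x \<bullet> b))"
    for x :: "real^'n"
  proof -
    have "(\<Prod>b\<in>Basis. std_normal_density (x \<bullet> b)) =
        (1 / sqrt (2 * pi)) ^ CARD('n) * exp (\<Sum>b\<in>Basis. - (x \<bullet> b)\<^sup>2 / 2)"
      unfolding std_normal_density_def prod.distrib by (subst exp_sum) simp_all
    also have "(\<Sum>b\<in>Basis. - (x \<bullet> b)\<^sup>2 / 2) = - (x \<bullet> x) / 2"
      by (subst euclidean_inner[of x x]) (simp add: sum_negf sum_divide_distrib power2_eq_square)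
    finally show ?thesis
      by (simp add: power_one_over real_sqrt_power real_sqrt_mult power_mult_distrib)
  qed
  then show ?thesis
    by (simp add: gaussian_def matrix_inv_mat_1 prod_ennreal)
qed

lemma nn_integral_std_normal_density: "(\<integral>\<^sup>+x. ennreal (std_normal_density x) \<partial>lborel) = 1"
proof -
  have "emeasure (density lborel std_normal_density) (space (density lborel std_normal_density)) = 1"
    by (rule prob_space.emeasure_space_1[OF prob_space_normal_density]) simp
  then show ?thesis by (simp add: emeasure_density)
qed

lemma nn_integral_std_normal_second_moment:
  "(\<integral>\<^sup>+x. ennreal (x\<^sup>2) * ennreal (std_normal_density x) \<partial>lborel) = 1"
proof -
  have "has_bochner_integral lborel (\<lambda>x. std_normal_density x * x\<^sup>2) 1"
    using std_normal_moment_even[of 1] by simp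
  then have "(\<integral>\<^sup>+x. ennreal (std_normal_density x * x\<^sup>2) \<partial>lborel) = 1"
    by (subst nn_integral_eq_integral) (auto simp: has_bochner_integral_iff)
  then show ?thesis by (simp add: ennreal_mult' ac_simps)
qed

lemma prob_space_gaussian_mat_1: "prob_space (gaussian (mat 1 :: real^'n^'n))"
proof (rule prob_spaceI)
  have "emeasure (gaussian (mat 1 :: real^'n^'n)) UNIV =
      (\<integral>\<^sup>+x. (\<Prod>b\<in>Basis. ennreal (std_normal_density (x \<bullet> b))) \<partial>(lborel :: (real^'n) measure))"
    unfolding gaussian_mat_1 by (subst emeasure_density) auto
  also have "\<dots> = 1"
    by (subst nn_integral_lborel_prod) (auto simp: nn_integral_std_normal_density)
  finally show "emeasure (gaussian (mat 1 :: real^'n^'n)) (space (gaussian (mat 1 :: real^'n^'n))) = 1"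
    by simp
qed

lemma nn_integral_gaussian_mat_1_square:
  "(\<integral>\<^sup>+x. ennreal ((x $ i)\<^sup>2) \<partial>gaussian (mat 1 :: real^'n^'n)) = 1"
proof -
  \<comment> \<open>The factor of the integrand in direction \<open>b\<close>: only coordinate
    \<open>i\<close> carries the square, every other factor integrates to 1 by itself.\<close>
  define f where "f b t = (if b = (axis i 1 :: real^'n) then ennreal (t\<^sup>2) else 1) * ennreal (std_normal_density t)"
    for b :: "real^'n" and t
  have [measurable]: "f b \<in> borel_measurable borel" for b
    unfolding f_def by measurable
  have "(\<Prod>b\<in>Basis. ennreal (std_normal_density (x \<bullet> b))) * ennreal ((x $ i)\<^sup>2) = (\<Prod>b\<in>Basis. f b (x \<bullet> b))" for x
    unfolding f_def prod.distrib by (simp add: inner_axis mult.commute prod.delta')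
  then have "(\<integral>\<^sup>+x. ennreal ((x $ i)\<^sup>2) \<partial>gaussian (mat 1 :: real^'n^'n)) = (\<integral>\<^sup>+x. (\<Prod>b\<in>Basis. f b (x \<bullet> b)) \<partial>lborel)"
    unfolding gaussian_mat_1 by (subst nn_integral_density) auto
  also have "\<dots> = (\<Prod>b\<in>Basis. \<integral>\<^sup>+t. f b t \<partial>lborel)"
    by (subst nn_integral_lborel_prod) auto
  also have "\<dots> = 1"
  proof (intro prod.neutral ballI)
    show "(\<integral>\<^sup>+t. f b t \<partial>lborel) = 1" for b
      by (cases "b = axis i 1")
        (simp_all add: f_def nn_integral_std_normal_density nn_integral_std_normal_second_moment)
  qed
  finally show ?thesis .
qed

text \<open>The substitution \<open>y = A *v x\<close> preserves the quadratic form in the exponent,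
  and the Jacobian is absorbed by the normalization, since \<open>det A\<close> enters the
  determinant of the new covariance squared.\<close>

lemma gaussian_linear_image:
  fixes A C :: "real^'n^'n"
  assumes C: "pos_def C" and A: "invertible A"
  shows "distr (gaussian C) borel ((*v) A) = gaussian (A ** C ** transpose A)"
proof (rule measure_eqI)
  let ?D = "A ** C ** transpose A"
  let ?d = "\<lambda>C x. ennreal (exp (- (x \<bullet> (matrix_inv C *v x)) / 2) / sqrt ((2 * pi) ^ CARD('n) * det C))"
  note invA = matrix_inv_mult[OF A] and invC = matrix_inv_mult[OF pos_def_invertible[OF C]]
  have At: "transpose A ** transpose (matrix_inv A) = mat 1"
    by (metis invA(2) matrix_transpose_mul transpose_mat)
  have iD: "matrix_inv ?D = transpose (matrix_inv A) ** matrix_inv C ** matrix_inv A"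
  proof (rule matrix_inv_eqI)
    have "?D ** (transpose (matrix_inv A) ** matrix_inv C ** matrix_inv A)
        = A ** C ** (transpose A ** transpose (matrix_inv A)) ** matrix_inv C ** matrix_inv A"
      by (simp add: matrix_mul_assoc)
    also have "\<dots> = A ** (C ** matrix_inv C) ** matrix_inv A"
      by (simp add: At matrix_mul_assoc)
    finally show "?D ** (transpose (matrix_inv A) ** matrix_inv C ** matrix_inv A) = mat 1"
      by (simp add: invA invC)
  qed
  have q: "(A *v x) \<bullet> (matrix_inv ?D *v (A *v x)) = x \<bullet> (matrix_inv C *v x)" for x
  proof -
    have "matrix_inv A *v (A *v x) = x" by (simp add: matrix_vector_mul_assoc invA)
    then have "matrix_inv ?D *v (A *v x) = transpose (matrix_inv A) *v (matrix_inv C *v x)"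
      by (simp add: iD flip: matrix_vector_mul_assoc)
    then show ?thesis
      by (simp add: inner_matrix_vector_right[of "A *v x"] \<open>matrix_inv A *v (A *v x) = x\<close>)
  qed
  have dA: "det A \<noteq> 0" using A by (simp add: invertible_det_nz)
  have sq: "sqrt ((2 * pi) ^ CARD('n) * det ?D) = \<bar>det A\<bar> * sqrt ((2 * pi) ^ CARD('n) * det C)"
    by (simp add: det_mul det_transpose real_sqrt_mult ac_simps)
  have d: "ennreal \<bar>det A\<bar> * ?d ?D (A *v x) = ?d C x" for x
    unfolding q sq using dA by (subst ennreal_mult'[symmetric]) (auto simp: field_simps)
  fix S assume "S \<in> sets (distr (gaussian C) borel ((*v) A))"
  then have S [measurable]: "S \<in> sets borel" by simp
  have "emeasure (distr (gaussian C) borel ((*v) A)) S = emeasure (gaussian C) ((*v) A -` S)"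
    by (subst emeasure_distr) auto
  also have "\<dots> = (\<integral>\<^sup>+x. ?d C x * indicator ((*v) A -` S) x \<partial>lborel)"
    unfolding gaussian_def using measurable_sets_borel[OF borel_measurable_linear[OF matrix_vector_mul_linear] S]
    by (subst emeasure_density) auto
  also have "\<dots> = (\<integral>\<^sup>+x. ennreal \<bar>det A\<bar> * (?d ?D (A *v x) * indicator S (A *v x)) \<partial>lborel)"
    by (intro nn_integral_cong) (simp only: mult.assoc[symmetric] d indicator_def vimage_eq)
  also have "\<dots> = (\<integral>\<^sup>+y. ?d ?D y * indicator S y \<partial>lborel)"
    by (subst nn_integral_lborel_matrix[OF A, of "\<lambda>y. ?d ?D y * indicator S y"])
      (auto simp: nn_integral_cmult)
  also have "\<dots> = emeasure (gaussian ?D) S"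
    unfolding gaussian_def by (subst emeasure_density) auto
  finally show "emeasure (distr (gaussian C) borel ((*v) A)) S = emeasure (gaussian ?D) S" .
qed simp

text \<open>Transfers total mass and moments from the standard Gaussian to every positive definite
  covariance.\<close>

lemma gaussian_eq_distr:
  assumes "pos_def C"
  shows "gaussian C = distr (gaussian (mat 1)) borel ((*v) (mat_sqrt C))"
  using gaussian_linear_image[OF pos_def_mat_1 pos_def_invertible[OF pos_def_mat_sqrt[OF assms]]] assms
  by (simp add: pos_def_sym[OF pos_def_mat_sqrt] mat_sqrt_mult_self)

lemma prob_space_gaussian: "pos_def C \<Longrightarrow> prob_space (gaussian C)"
  by (subst gaussian_eq_distr) (auto intro!: prob_space.prob_space_distr prob_space_gaussian_mat_1)

section \<open>Moments of Gaussian measures\<close>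

lemma gaussian_mat_1_moments:
  fixes i j :: "'n::finite"
  defines "N \<equiv> gaussian (mat 1 :: real^'n^'n)"
  shows "integrable N (\<lambda>x. x $ i * x $ j)"
    and "(\<integral>x. x $ i * x $ j \<partial>N) = (if i = j then 1 else 0)"
proof -
  have sq: "integrable N (\<lambda>x. (x $ i)\<^sup>2)" for i
    using nn_integral_gaussian_mat_1_square[of i]
    by (intro integrableI_nonneg) (auto simp: N_def)
  show int: "integrable N (\<lambda>x. x $ i * x $ j)" for i j
  proof (rule Bochner_Integration.integrable_bound)
    show "integrable N (\<lambda>x. (x $ i)\<^sup>2 + (x $ j)\<^sup>2)" using sq by auto
    show "(\<lambda>x. x $ i * x $ j) \<in> borel_measurable N" unfolding N_def by measurable
    show "AE x in N. norm (x $ i * x $ j) \<le> norm ((x $ i)\<^sup>2 + (x $ j)\<^sup>2)"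
    proof (intro AE_I2)
      fix x :: "real^'n"
      have "2 * (\<bar>x $ i\<bar> * \<bar>x $ j\<bar>) \<le> (x $ i)\<^sup>2 + (x $ j)\<^sup>2"
        using sum_squares_bound[of "\<bar>x $ i\<bar>" "\<bar>x $ j\<bar>"] by simp
      moreover have "0 \<le> \<bar>x $ i\<bar> * \<bar>x $ j\<bar>" by simp
      ultimately have "\<bar>x $ i\<bar> * \<bar>x $ j\<bar> \<le> (x $ i)\<^sup>2 + (x $ j)\<^sup>2" by linarith
      then show "norm (x $ i * x $ j) \<le> norm ((x $ i)\<^sup>2 + (x $ j)\<^sup>2)" by (simp add: abs_mult)
    qed
  qed
  show "(\<integral>x. x $ i * x $ j \<partial>N) = (if i = j then 1 else 0)"
  proof (cases "i = j")
    case True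
    have "(\<integral>x. (x $ i)\<^sup>2 \<partial>N) = 1"
      using nn_integral_gaussian_mat_1_square[of i] by (subst integral_eq_nn_integral) (auto simp: N_def)
    then show ?thesis using True by (simp add: power2_eq_square)
  next
    case False
    \<comment> \<open>The reflection in coordinate \<open>i\<close>. It preserves the standard
      Gaussian and changes the sign of \<open>x $ i * x $ j\<close>, so the mixed moment equals its
      own negative.\<close>
    define R :: "real^'n^'n" where "R = (\<chi> k l. if k = l then (if k = i then -1 else 1) else 0)"
    have tR: "transpose R = R" by (auto simp: R_def transpose_def vec_eq_iff)
    have R: "(R *v x) $ k = (if k = i then - x $ k else x $ k)" for x k
    proof -
      have "(R *v x) $ k = (\<Sum>l\<in>UNIV. (if k = i then - x $ l else x $ l) * (if k = l then 1 else 0))"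
        unfolding matrix_vector_mult_def R_def vec_lambda_beta by (intro sum.cong) auto
      then show ?thesis by (simp only: sum_mult_delta)
    qed
    have "R *v (R *v x) = x" for x by (simp add: vec_eq_iff R)
    then have RR: "R ** R = mat 1" by (simp add: matrix_eq matrix_vector_mul_assoc)
    then have "invertible R" unfolding invertible_def by blast
    from gaussian_linear_image[OF pos_def_mat_1 this]
    have "N = distr N borel ((*v) R)" by (simp add: tR RR N_def)
    then have "(\<integral>x. x $ i * x $ j \<partial>N) = (\<integral>x. x $ i * x $ j \<partial>distr N borel ((*v) R))" by simp
    also have "\<dots> = (\<integral>x. (R *v x) $ i * (R *v x) $ j \<partial>N)"
      by (subst integral_distr) (auto simp: N_def)
    also have "\<dots> = - (\<integral>x. x $ i * x $ j \<partial>N)"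
      using False by (simp add: R)
    finally show ?thesis using False by simp
  qed
qed

lemma gaussian_second_moment:
  assumes C: "pos_def C"
  shows integrable_gaussian_second_moment: "integrable (gaussian C) (\<lambda>x. x $ i * x $ j)"
    and integral_gaussian_second_moment: "(\<integral>x. x $ i * x $ j \<partial>gaussian C) = C $ i $ j"
proof -
  let ?S = "mat_sqrt C"
  have eq: "(?S *v x) $ i * (?S *v x) $ j =
      (\<Sum>k\<in>UNIV. \<Sum>l\<in>UNIV. ?S $ i $ k * ?S $ j $ l * (x $ k * x $ l))" for x
    by (simp add: matrix_vector_mult_def sum_product ac_simps)
  show "integrable (gaussian C) (\<lambda>x. x $ i * x $ j)"
    unfolding gaussian_eq_distr[OF C]
    by (subst integrable_distr_eq) (auto simp: eq intro!: Bochner_Integration.integrable_sum gaussian_mat_1_moments)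
  have "(\<integral>x. x $ i * x $ j \<partial>gaussian C) =
      (\<integral>x. (?S *v x) $ i * (?S *v x) $ j \<partial>gaussian (mat 1))"
    by (subst gaussian_eq_distr[OF C], subst integral_distr) auto
  also have "\<dots> = (\<Sum>k\<in>UNIV. \<Sum>l\<in>UNIV. ?S $ i $ k * ?S $ j $ l * (if k = l then 1 else 0))"
    unfolding eq by (simp add: gaussian_mat_1_moments cong: if_cong)
  also have "\<dots> = (?S ** transpose ?S) $ i $ j"
    by (simp add: matrix_matrix_mult_def transpose_def sum_mult_delta)
  also have "\<dots> = C $ i $ j"
    using C by (simp add: pos_def_sym[OF pos_def_mat_sqrt] mat_sqrt_mult_self)
  finally show "(\<integral>x. x $ i * x $ j \<partial>gaussian C) = C $ i $ j" .
qed

text \<open>The measure is invariant under reflection at the origin, so each mean is its own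
  negative.\<close>

lemma integral_gaussian_first_moment:
  fixes C :: "real^'n^'n"
  assumes C: "pos_def C"
  shows "(\<integral>x. x $ i \<partial>gaussian C) = 0"
proof -
  have m: "(- mat 1) ** (- mat 1) = (mat 1 :: real^'n^'n)"
    by (simp add: matrix_minus_left matrix_minus_right)
  then have "invertible (- mat 1 :: real^'n^'n)" unfolding invertible_def by blast
  from gaussian_linear_image[OF C this]
  have "gaussian C = distr (gaussian C) borel ((*v) (- mat 1))"
    by (simp add: transpose_minus matrix_minus_left matrix_minus_right)
  then have "(\<integral>x. x $ i \<partial>gaussian C) = (\<integral>x. x $ i \<partial>distr (gaussian C) borel ((*v) (- mat 1)))" by simp
  also have "\<dots> = - (\<integral>x. x $ i \<partial>gaussian C)"
    by (subst integral_distr) (auto simp: matrix_vector_minus_left)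
  finally show ?thesis by simp
qed

lemma cov_matrix_gaussian: "pos_def C \<Longrightarrow> cov_matrix (gaussian C) = C"
  by (simp add: cov_matrix_def vec_eq_iff integral_gaussian_first_moment integral_gaussian_second_moment)

lemma gaussian_quadratic_form:
  fixes C Q :: "real^'n^'n"
  assumes C: "pos_def C"
  shows "integrable (gaussian C) (\<lambda>x. x \<bullet> (Q *v x))"
    and "(\<integral>x. x \<bullet> (Q *v x) \<partial>gaussian C) = (\<Sum>i\<in>UNIV. \<Sum>j\<in>UNIV. Q $ i $ j * C $ i $ j)"
proof -
  have eq: "x \<bullet> (Q *v x) = (\<Sum>i\<in>UNIV. \<Sum>j\<in>UNIV. Q $ i $ j * (x $ i * x $ j))" for x
    by (simp add: inner_vec_def matrix_vector_mult_def sum_distrib_left ac_simps)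
  show "integrable (gaussian C) (\<lambda>x. x \<bullet> (Q *v x))"
    unfolding eq by (auto intro!: Bochner_Integration.integrable_sum gaussian_second_moment[OF C])
  show "(\<integral>x. x \<bullet> (Q *v x) \<partial>gaussian C) = (\<Sum>i\<in>UNIV. \<Sum>j\<in>UNIV. Q $ i $ j * C $ i $ j)"
    unfolding eq by (simp add: gaussian_second_moment[OF C])
qed

text \<open>The factor \<open>c\<close> is forced by total mass 1. Marginals and models can thus be
  recognized from the shape of their exponent, without a determinant identity for the
  constant.\<close>

lemma gaussian_eqI:
  fixes C :: "real^'n^'n"
  assumes C: "pos_def C" and M: "prob_space M"
    and eq: "M = density lborel (\<lambda>x. c * ennreal (exp (- (x \<bullet> (matrix_inv C *v x)) / 2)))"
  shows "M = gaussian C"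
proof -
  let ?e = "\<lambda>x. ennreal (exp (- (x \<bullet> (matrix_inv C *v x)) / 2))"
  let ?s = "sqrt ((2 * pi) ^ CARD('n) * det C)"
  define I where "I = (\<integral>\<^sup>+x. ?e x \<partial>lborel)"
  have s: "?s > 0" using det_pos_def[OF C] by simp
  have g: "gaussian C = density lborel (\<lambda>x. ennreal (1 / ?s) * ?e x)"
    unfolding gaussian_def using s
    by (intro density_cong) (auto simp: ennreal_mult'[symmetric] field_simps)
  have "c * I = 1"
    using prob_space.emeasure_space_1[OF M] unfolding eq I_def
    by (simp add: emeasure_density nn_integral_cmult)
  moreover have *: "ennreal (1 / ?s) * I = 1"
    using prob_space.emeasure_space_1[OF prob_space_gaussian[OF C]] unfolding g I_def
    by (simp add: emeasure_density nn_integral_cmult)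
  \<comment> \<open>Both factors are inverse to \<open>I\<close>, hence equal; this replaces
    cancellation, which can fail in \<open>ennreal\<close>.\<close>
  ultimately have "c = ennreal (1 / ?s)"
    by (metis mult.assoc mult.commute mult_1)
  then show ?thesis by (simp add: g eq)
qed

section \<open>Block vectors and block matrices\<close>

definition join_vec :: "(real^'m) \<times> (real^'n) \<Rightarrow> real^('m::finite + 'n::finite)" where
  "join_vec z = (\<chi> i. case i of Inl a \<Rightarrow> fst z $ a | Inr b \<Rightarrow> snd z $ b)"

lemma join_vec_nth [simp]: "join_vec z $ Inl a = fst z $ a" "join_vec z $ Inr b = snd z $ b"
  by (simp_all add: join_vec_def)

lemma split_join_vec [simp]: "split_vec (join_vec z) = z"
  by (simp add: split_vec_def join_vec_def prod_eq_iff vec_eq_iff)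

lemma join_split_vec [simp]: "join_vec (split_vec x) = x"
  by (simp add: split_vec_def join_vec_def vec_eq_iff split: sum.split)

lemma sum_UNIV_Plus:
  "(\<Sum>i\<in>(UNIV :: ('m::finite + 'n::finite) set). f i) = (\<Sum>a\<in>UNIV. f (Inl a)) + (\<Sum>b\<in>UNIV. f (Inr b))"
  by (subst UNIV_Plus_UNIV[symmetric], subst sum.Plus) simp_all

lemma prod_UNIV_Plus:
  "(\<Prod>i\<in>(UNIV :: ('m::finite + 'n::finite) set). f i) = (\<Prod>a\<in>UNIV. f (Inl a)) * (\<Prod>b\<in>UNIV. f (Inr b))"
  by (subst UNIV_Plus_UNIV[symmetric], subst prod.Plus) simp_all

lemma vec_Plus_eq_iff: "x = y \<longleftrightarrow> (\<forall>a. x $ Inl a = y $ Inl a) \<and> (\<forall>b. x $ Inr b = y $ Inr b)"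
  by (auto simp: vec_eq_iff) (metis sum.exhaust_sel)

lemma inner_join_vec: "join_vec z \<bullet> join_vec w = fst z \<bullet> fst w + snd z \<bullet> snd w"
  by (simp add: inner_vec_def sum_UNIV_Plus)

lemma join_vec_add: "join_vec (z + w) = join_vec z + join_vec w"
  by (simp add: vec_Plus_eq_iff)

lemma linear_join_vec: "linear join_vec"
  by (rule linearI) (simp_all add: vec_Plus_eq_iff)

lemma linear_split_vec: "linear split_vec"
  by (rule linearI) (simp_all add: split_vec_def vec_eq_iff prod_eq_iff)

lemma measurable_join_vec [measurable]: "join_vec \<in> borel \<rightarrow>\<^sub>M borel"
  by (rule borel_measurable_linear[OF linear_join_vec])

lemma measurable_split_vec [measurable]: "split_vec \<in> borel \<rightarrow>\<^sub>M borel"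
  by (rule borel_measurable_linear[OF linear_split_vec])

lemma block_matrix_nth [simp]:
  "block_matrix P Q R S $ Inl a $ Inl b = P $ a $ b"
  "block_matrix P Q R S $ Inl a $ Inr c = Q $ a $ c"
  "block_matrix P Q R S $ Inr c $ Inl a = R $ c $ a"
  "block_matrix P Q R S $ Inr c $ Inr d = S $ c $ d"
  by (simp_all add: block_matrix_def)

lemma block_matrix_mult_vec:
  "block_matrix P Q R S *v join_vec (u, v) = join_vec (P *v u + Q *v v, R *v u + S *v v)"
  by (simp add: vec_Plus_eq_iff matrix_vector_mult_def sum_UNIV_Plus)

lemma block_matrix_mult:
  "block_matrix P Q R S ** block_matrix P' Q' R' S' =
    block_matrix (P ** P' + Q ** R') (P ** Q' + Q ** S') (R ** P' + S ** R') (R ** Q' + S ** S')"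
  by (simp add: vec_Plus_eq_iff matrix_matrix_mult_def sum_UNIV_Plus)

lemma block_matrix_1: "block_matrix (mat 1) 0 0 (mat 1) = mat 1"
  by (simp add: vec_Plus_eq_iff mat_def)

lemma transpose_block_matrix:
  "transpose (block_matrix P Q R S) =
    block_matrix (transpose P) (transpose R) (transpose Q) (transpose S)"
  by (simp add: vec_Plus_eq_iff transpose_def)

lemma block_matrix_eq_iff:
  "block_matrix P Q R S = block_matrix P' Q' R' S' \<longleftrightarrow> P = P' \<and> Q = Q' \<and> R = R' \<and> S = S'"
  by (auto simp: vec_Plus_eq_iff vec_eq_iff)

lemma block_quadratic_form:
  "join_vec (u, v) \<bullet> (block_matrix P Q R S *v join_vec (u, v)) =
    u \<bullet> (P *v u) + u \<bullet> (Q *v v) + v \<bullet> (R *v u) + v \<bullet> (S *v v)"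
  by (simp add: block_matrix_mult_vec inner_join_vec inner_add_right)

lemma join_vec_eq_0_iff: "join_vec (u, v) = 0 \<longleftrightarrow> u = 0 \<and> v = 0"
  by (auto simp: vec_Plus_eq_iff vec_eq_iff)

lemma pos_def_block_matrixD:
  assumes "pos_def (block_matrix P Q R S)"
  shows "pos_def P" "pos_def S" "R = transpose Q"
proof -
  have t: "transpose P = P" "transpose S = S" "transpose Q = R"
    using pos_def_sym[OF assms] by (simp_all add: transpose_block_matrix block_matrix_eq_iff)
  have pos: "join_vec (u, v) \<bullet> (block_matrix P Q R S *v join_vec (u, v)) > 0" if "u \<noteq> 0 \<or> v \<noteq> 0" for u v
    using that assms by (simp add: pos_def_def join_vec_eq_0_iff)
  show "pos_def P" using t pos[of _ 0] by (simp add: pos_def_def block_quadratic_form)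
  show "pos_def S" using t pos[of 0] by (simp add: pos_def_def block_quadratic_form)
  show "R = transpose Q" using t by simp
qed

lemma pos_def_block_matrixI:
  assumes "transpose P = P" "transpose S = S" "R = transpose Q"
    and "\<And>u v. u \<noteq> 0 \<or> v \<noteq> 0 \<Longrightarrow> u \<bullet> (P *v u) + u \<bullet> (Q *v v) + v \<bullet> (R *v u) + v \<bullet> (S *v v) > 0"
  shows "pos_def (block_matrix P Q R S)"
proof -
  have "x \<bullet> (block_matrix P Q R S *v x) > 0" if "x \<noteq> 0" for x
  proof -
    obtain u v where x: "x = join_vec (u, v)"
      by (metis join_split_vec surj_pair)
    then show ?thesis
      using that assms(4)[of u v] by (simp add: join_vec_eq_0_iff block_quadratic_form)
  qed
  then show ?thesis
    using assms by (simp add: pos_def_def transpose_block_matrix)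
qed

text \<open>The preimage of a box is a product of two boxes, and volumes multiply. This is what
  turns a density on the block space into a density on pairs.\<close>

lemma lborel_distr_join_vec: "distr lborel borel join_vec = lborel"
proof (rule lborel_eqI[symmetric])
  fix l u :: "real^('m::finite + 'n::finite)"
  assume lu: "\<And>b. b \<in> Basis \<Longrightarrow> l \<bullet> b \<le> u \<bullet> b"
  have le: "l $ i \<le> u $ i" for i using lu[of "axis i 1"] by (simp add: inner_axis)
  have all: "(\<forall>i::'m + 'n. P i) \<longleftrightarrow> (\<forall>a. P (Inl a)) \<and> (\<forall>b. P (Inr b))" for P
    by (metis sum.exhaust_sel)
  obtain l1 l2 u1 u2 where l: "l = join_vec (l1, l2)" and u: "u = join_vec (u1, u2)"
    by (metis join_split_vec surj_pair)
  have le': "\<forall>b\<in>Basis. l1 \<bullet> b \<le> u1 \<bullet> b" "\<forall>b\<in>Basis. l2 \<bullet> b \<le> u2 \<bullet> b"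
    using le[of "Inl _"] le[of "Inr _"] by (auto simp: l u Basis_vec_eq inner_axis)
  have "join_vec -` box l u = box l1 u1 \<times> box l2 u2"
    by (auto simp: l u mem_box_cart all)
  then have "emeasure (distr lborel borel join_vec) (box l u) =
      emeasure (lborel \<Otimes>\<^sub>M lborel) (box l1 u1 \<times> box l2 u2)"
    by (simp add: emeasure_distr lborel_prod)
  also have "\<dots> = ennreal (\<Prod>i\<in>UNIV. (u1 - l1) $ i) * ennreal (\<Prod>i\<in>UNIV. (u2 - l2) $ i)"
    using le' by (simp add: lborel.emeasure_pair_measure_Times emeasure_lborel_box_eq prod_Basis_vec inner_axis
        del: vector_minus_component)
  also have "\<dots> = ennreal ((\<Prod>i\<in>UNIV. (u1 - l1) $ i) * (\<Prod>i\<in>UNIV. (u2 - l2) $ i))"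
    using le[of "Inl _"] by (subst ennreal_mult') (auto simp: l u intro!: prod_nonneg)
  finally show "emeasure (distr lborel borel join_vec) (box l u) = (\<Prod>b\<in>Basis. (u - l) \<bullet> b)"
    by (simp add: prod_Basis_vec inner_axis prod_UNIV_Plus l u)
qed simp

section \<open>Gaussian measures on a product\<close>

lemma measurable_fst_borel [measurable]:
  "(fst :: 'a::euclidean_space \<times> 'b::euclidean_space \<Rightarrow> 'a) \<in> borel \<rightarrow>\<^sub>M borel"
  by (rule borel_measurable_linear[OF linear_fst])

lemma measurable_snd_borel [measurable]:
  "(snd :: 'a::euclidean_space \<times> 'b::euclidean_space \<Rightarrow> 'b) \<in> borel \<rightarrow>\<^sub>M borel"
  by (rule borel_measurable_linear[OF linear_snd])

lemma sets_gaussian_prod [measurable_cong, simp]: "sets (gaussian_prod C) = sets borel"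
  by (simp add: gaussian_prod_def)

lemma space_gaussian_prod [simp]: "space (gaussian_prod C) = UNIV"
  by (simp add: gaussian_prod_def)

lemma prob_space_gaussian_prod: "pos_def C \<Longrightarrow> prob_space (gaussian_prod C)"
  unfolding gaussian_prod_def by (intro prob_space.prob_space_distr prob_space_gaussian) auto

lemma gaussian_prod_density:
  fixes C :: "real^('m::finite + 'n::finite)^('m + 'n)"
  shows "gaussian_prod C = density lborel (\<lambda>z. ennreal
    (exp (- (join_vec z \<bullet> (matrix_inv C *v join_vec z)) / 2) / sqrt ((2 * pi) ^ CARD('m + 'n) * det C)))"
proof -
  let ?d = "\<lambda>x. ennreal (exp (- (x \<bullet> (matrix_inv C *v x)) / 2) / sqrt ((2 * pi) ^ CARD('m + 'n) * det C))"
  have "gaussian C = distr (density lborel (\<lambda>z. ?d (join_vec z))) borel join_vec"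
    unfolding gaussian_def
    by (subst lborel_distr_join_vec[symmetric], subst density_distr) auto
  then have "gaussian_prod C = distr (density lborel (\<lambda>z. ?d (join_vec z))) borel (split_vec \<circ> join_vec)"
    unfolding gaussian_prod_def by (simp add: distr_distr)
  also have "\<dots> = density lborel (\<lambda>z. ?d (join_vec z))"
    by (simp add: o_def distr_id2)
  finally show ?thesis .
qed

text \<open>Carries \<open>gaussian_eqI\<close> from the block space to pairs along
  \<open>join_vec\<close>.\<close>

lemma gaussian_prod_eqI:
  fixes C :: "real^('m::finite + 'n::finite)^('m + 'n)"
  assumes C: "pos_def C" and M: "prob_space M"
    and eq: "M = density lborel (\<lambda>z. c * ennreal (exp (- (join_vec z \<bullet> (matrix_inv C *v join_vec z)) / 2)))"
  shows "M = gaussian_prod C"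
proof -
  have [measurable_cong]: "sets M = sets borel" unfolding eq by simp
  have "distr M borel join_vec =
      density (distr lborel borel join_vec) (\<lambda>x. c * ennreal (exp (- (x \<bullet> (matrix_inv C *v x)) / 2)))"
    unfolding eq by (subst density_distr) auto
  then have "distr M borel join_vec = gaussian C"
    unfolding lborel_distr_join_vec by (intro gaussian_eqI[OF C prob_space.prob_space_distr[OF M]]) auto
  then have "gaussian_prod C = distr (distr M borel join_vec) borel split_vec"
    by (simp add: gaussian_prod_def)
  also have "\<dots> = M"
    by (subst distr_distr) (auto simp: o_def eq intro!: distr_id2)
  finally show ?thesis by simp
qed

section \<open>Marginals of Gaussian measures on a product\<close>

lemma distr_fst_density:
  fixes f :: "'a::euclidean_space \<times> 'b::euclidean_space \<Rightarrow> ennreal"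
  assumes [measurable]: "f \<in> borel_measurable borel"
  shows "distr (density lborel f) borel fst = density lborel (\<lambda>u. \<integral>\<^sup>+v. f (u, v) \<partial>lborel)"
proof (rule measure_eqI)
  have [measurable]: "f \<in> borel_measurable (lborel \<Otimes>\<^sub>M lborel)"
    by (simp add: lborel_prod)
  fix S assume "S \<in> sets (distr (density lborel f) borel fst)"
  then have S [measurable]: "S \<in> sets borel" by simp
  have "emeasure (distr (density lborel f) borel fst) S = (\<integral>\<^sup>+z. f z * indicator (fst -` S) z \<partial>lborel)"
  proof -
    have "fst -` S \<in> sets (borel :: ('a \<times> 'b) measure)"
      by (rule measurable_sets_borel[OF measurable_fst_borel S])
    then show ?thesis by (subst emeasure_distr) (auto simp: emeasure_density)
  qed
  also have "\<dots> = (\<integral>\<^sup>+z. f z * indicator S (fst z) \<partial>(lborel \<Otimes>\<^sub>M lborel))"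
    unfolding lborel_prod by (intro nn_integral_cong) (auto simp: indicator_def)
  also have "\<dots> = (\<integral>\<^sup>+u. \<integral>\<^sup>+v. f (u, v) * indicator S u \<partial>lborel \<partial>lborel)"
    by (subst lborel.nn_integral_fst[symmetric]) auto
  also have "\<dots> = emeasure (density lborel (\<lambda>u. \<integral>\<^sup>+v. f (u, v) \<partial>lborel)) S"
    by (subst emeasure_density) (auto simp: nn_integral_multc)
  finally show "emeasure (distr (density lborel f) borel fst) S =
      emeasure (density lborel (\<lambda>u. \<integral>\<^sup>+v. f (u, v) \<partial>lborel)) S" .
qed simp

lemma distr_snd_density:
  fixes f :: "'a::euclidean_space \<times> 'b::euclidean_space \<Rightarrow> ennreal"
  assumes [measurable]: "f \<in> borel_measurable borel"
  shows "distr (density lborel f) borel snd = density lborel (\<lambda>v. \<integral>\<^sup>+u. f (u, v) \<partial>lborel)"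
proof (rule measure_eqI)
  have [measurable]: "f \<in> borel_measurable (lborel \<Otimes>\<^sub>M lborel)"
    by (simp add: lborel_prod)
  fix S assume "S \<in> sets (distr (density lborel f) borel snd)"
  then have S [measurable]: "S \<in> sets borel" by simp
  have "emeasure (distr (density lborel f) borel snd) S = (\<integral>\<^sup>+z. f z * indicator (snd -` S) z \<partial>lborel)"
  proof -
    have "snd -` S \<in> sets (borel :: ('a \<times> 'b) measure)"
      by (rule measurable_sets_borel[OF measurable_snd_borel S])
    then show ?thesis by (subst emeasure_distr) (auto simp: emeasure_density)
  qed
  also have "\<dots> = (\<integral>\<^sup>+z. f z * indicator S (snd z) \<partial>(lborel \<Otimes>\<^sub>M lborel))"
    unfolding lborel_prod by (intro nn_integral_cong) (auto simp: indicator_def)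
  also have "\<dots> = (\<integral>\<^sup>+v. \<integral>\<^sup>+u. f (u, v) * indicator S v \<partial>lborel \<partial>lborel)"
    by (subst lborel_pair.nn_integral_snd[symmetric]) auto
  also have "\<dots> = emeasure (density lborel (\<lambda>v. \<integral>\<^sup>+u. f (u, v) \<partial>lborel)) S"
    by (subst emeasure_density) (auto simp: nn_integral_multc)
  finally show "emeasure (distr (density lborel f) borel snd) S =
      emeasure (density lborel (\<lambda>v. \<integral>\<^sup>+u. f (u, v) \<partial>lborel)) S" .
qed simp

lemma quadratic_form_add:
  assumes "transpose M = M"
  shows "(x + y) \<bullet> (M *v (x + y)) = x \<bullet> (M *v x) + 2 * (y \<bullet> (M *v x)) + y \<bullet> (M *v (y :: real^'n))"
proof -
  have "x \<bullet> (M *v y) = y \<bullet> (M *v x)"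
    by (metis assms inner_commute inner_matrix_vector_right)
  then show ?thesis
    by (simp add: matrix_vector_right_distrib inner_add_left inner_add_right)
qed

text \<open>Completing the square: \<open>C (Cuu\<^sup>-\<^sup>1 u, 0) = (u, K u)\<close> makes \<open>(u, K u)\<close> and \<open>(0, w)\<close>
  orthogonal with respect to \<open>C\<^sup>-\<^sup>1\<close>.\<close>

lemma block_complete_square_fst:
  fixes Cuu :: "real^'m::finite^'m" and Cvv :: "real^'n::finite^'n"
    and Cuv :: "real^'n^'m" and Cvu :: "real^'m^'n"
  defines "C \<equiv> block_matrix Cuu Cuv Cvu Cvv"
  defines "q \<equiv> \<lambda>u v. join_vec (u, v) \<bullet> (matrix_inv C *v join_vec (u, v))"
  defines "K \<equiv> Cvu ** matrix_inv Cuu"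
  assumes C: "pos_def C"
  shows "q u (K *v u + w) = u \<bullet> (matrix_inv Cuu *v u) + q 0 w"
proof -
  note inv = matrix_inv_mult[OF pos_def_invertible[OF C]]
  note invu = matrix_inv_mult[OF pos_def_invertible[OF pos_def_block_matrixD(1)[OF C[unfolded C_def]]]]
  have "C *v join_vec (matrix_inv Cuu *v u, 0) = join_vec (u, K *v u)"
    by (simp add: C_def K_def block_matrix_mult_vec matrix_vector_mul_assoc invu)
  then have "matrix_inv C *v join_vec (u, K *v u) = join_vec (matrix_inv Cuu *v u, 0)"
    by (metis inv(2) matrix_vector_mul_assoc matrix_vector_mul_lid)
  moreover have "join_vec (u, K *v u + w) = join_vec (u, K *v u) + join_vec (0, w)"
    by (simp flip: join_vec_add)
  ultimately show ?thesis
    unfolding q_def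
    by (simp add: quadratic_form_add[OF pos_def_sym[OF pos_def_matrix_inv[OF C]]] inner_join_vec)
qed

lemma block_complete_square_snd:
  fixes Cuu :: "real^'m::finite^'m" and Cvv :: "real^'n::finite^'n"
    and Cuv :: "real^'n^'m" and Cvu :: "real^'m^'n"
  defines "C \<equiv> block_matrix Cuu Cuv Cvu Cvv"
  defines "q \<equiv> \<lambda>u v. join_vec (u, v) \<bullet> (matrix_inv C *v join_vec (u, v))"
  defines "K \<equiv> Cuv ** matrix_inv Cvv"
  assumes C: "pos_def C"
  shows "q (K *v v + w) v = v \<bullet> (matrix_inv Cvv *v v) + q w 0"
proof -
  note inv = matrix_inv_mult[OF pos_def_invertible[OF C]]
  note invv = matrix_inv_mult[OF pos_def_invertible[OF pos_def_block_matrixD(2)[OF C[unfolded C_def]]]]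
  have "C *v join_vec (0, matrix_inv Cvv *v v) = join_vec (K *v v, v)"
    by (simp add: C_def K_def block_matrix_mult_vec matrix_vector_mul_assoc invv)
  then have "matrix_inv C *v join_vec (K *v v, v) = join_vec (0, matrix_inv Cvv *v v)"
    by (metis inv(2) matrix_vector_mul_assoc matrix_vector_mul_lid)
  moreover have "join_vec (K *v v + w, v) = join_vec (K *v v, v) + join_vec (w, 0)"
    by (simp flip: join_vec_add)
  ultimately show ?thesis
    unfolding q_def
    by (simp add: quadratic_form_add[OF pos_def_sym[OF pos_def_matrix_inv[OF C]]] inner_join_vec)
qed

lemma ennreal_exp_add_half:
  "ennreal (exp (- (a + b) / 2) / s) = ennreal (exp (- b / 2) / s) * ennreal (exp (- a / 2))"
proof -
  have "- (a + b) / 2 = - b / 2 + - a / 2" by simp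
  then have "exp (- (a + b) / 2) / s = exp (- b / 2) / s * exp (- a / 2)"
    by (simp only: exp_add times_divide_eq_left)
  then show ?thesis by (simp only: ennreal_mult''[OF exp_ge_zero])
qed

lemma measurable_Pair_borel:
  fixes f :: "'a::euclidean_space \<times> 'b::euclidean_space \<Rightarrow> ennreal"
  assumes "f \<in> borel_measurable borel"
  shows measurable_Pair1_borel: "(\<lambda>v. f (u, v)) \<in> borel_measurable borel"
    and measurable_Pair2_borel: "(\<lambda>u. f (u, v)) \<in> borel_measurable borel"
  by (rule measurable_compose[OF borel_measurable_continuous_onI assms], intro continuous_intros)+

text \<open>Translating \<open>v\<close> by the conditional mean \<open>?K *v u\<close> splits the
  density into a function of \<open>u\<close> times a function of \<open>v\<close>. The integral of
  the second factor stays unevaluated as the constant in \<open>gaussian_eqI\<close>.\<close>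

lemma marginal_u_gaussian_prod:
  fixes Cuu :: "real^'m::finite^'m" and Cvv :: "real^'n::finite^'n"
  assumes C: "pos_def (block_matrix Cuu Cuv Cvu Cvv)"
  shows "marginal_u (gaussian_prod (block_matrix Cuu Cuv Cvu Cvv)) = gaussian Cuu"
proof (rule gaussian_eqI)
  let ?C = "block_matrix Cuu Cuv Cvu Cvv"
  let ?K = "Cvu ** matrix_inv Cuu"
  let ?s = "sqrt ((2 * pi) ^ CARD('m + 'n) * det ?C)"
  let ?d = "\<lambda>z. ennreal (exp (- (join_vec z \<bullet> (matrix_inv ?C *v join_vec z)) / 2) / ?s)"
  let ?c = "\<integral>\<^sup>+v. ?d (0 :: real^'m, v) \<partial>lborel"
  show "pos_def Cuu" by (rule pos_def_block_matrixD(1)[OF C])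
  show "prob_space (marginal_u (gaussian_prod ?C))"
    unfolding marginal_u_def by (intro prob_space.prob_space_distr prob_space_gaussian_prod C) auto
  have d [measurable]: "?d \<in> borel_measurable borel" by measurable
  have "(\<integral>\<^sup>+v. ?d (u, v) \<partial>lborel) = ?c * ennreal (exp (- (u \<bullet> (matrix_inv Cuu *v u)) / 2))" for u
  proof -
    have "(\<integral>\<^sup>+v. ?d (u, v) \<partial>lborel) = (\<integral>\<^sup>+v. ?d (u, ?K *v u + v) \<partial>lborel)"
      by (rule nn_integral_lborel_translation[symmetric]) (rule measurable_Pair1_borel[OF d])
    also have "\<dots> = (\<integral>\<^sup>+v. ?d (0, v) * ennreal (exp (- (u \<bullet> (matrix_inv Cuu *v u)) / 2)) \<partial>lborel)"
      unfolding block_complete_square_fst[OF C]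
      by (simp only: ennreal_exp_add_half)
    also have "\<dots> = ?c * ennreal (exp (- (u \<bullet> (matrix_inv Cuu *v u)) / 2))"
      by (rule nn_integral_multc) (use measurable_Pair1_borel[OF d] in simp)
    finally show ?thesis .
  qed
  then have eq: "(\<lambda>u. \<integral>\<^sup>+v. ?d (u, v) \<partial>lborel) =
      (\<lambda>u. ?c * ennreal (exp (- (u \<bullet> (matrix_inv Cuu *v u)) / 2)))"
    by (rule ext)
  show "marginal_u (gaussian_prod ?C) =
      density lborel (\<lambda>u. ?c * ennreal (exp (- (u \<bullet> (matrix_inv Cuu *v u)) / 2)))"
    unfolding marginal_u_def gaussian_prod_density by (subst distr_fst_density[OF d]) (simp only: eq)
qed

lemma marginal_v_gaussian_prod:
  fixes Cuu :: "real^'m::finite^'m" and Cvv :: "real^'n::finite^'n"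
  assumes C: "pos_def (block_matrix Cuu Cuv Cvu Cvv)"
  shows "marginal_v (gaussian_prod (block_matrix Cuu Cuv Cvu Cvv)) = gaussian Cvv"
proof (rule gaussian_eqI)
  let ?C = "block_matrix Cuu Cuv Cvu Cvv"
  let ?K = "Cuv ** matrix_inv Cvv"
  let ?s = "sqrt ((2 * pi) ^ CARD('m + 'n) * det ?C)"
  let ?d = "\<lambda>z. ennreal (exp (- (join_vec z \<bullet> (matrix_inv ?C *v join_vec z)) / 2) / ?s)"
  let ?c = "\<integral>\<^sup>+u. ?d (u, 0 :: real^'n) \<partial>lborel"
  show "pos_def Cvv" by (rule pos_def_block_matrixD(2)[OF C])
  show "prob_space (marginal_v (gaussian_prod ?C))"
    unfolding marginal_v_def by (intro prob_space.prob_space_distr prob_space_gaussian_prod C) auto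
  have d [measurable]: "?d \<in> borel_measurable borel" by measurable
  have "(\<integral>\<^sup>+u. ?d (u, v) \<partial>lborel) = ?c * ennreal (exp (- (v \<bullet> (matrix_inv Cvv *v v)) / 2))" for v
  proof -
    have "(\<integral>\<^sup>+u. ?d (u, v) \<partial>lborel) = (\<integral>\<^sup>+u. ?d (?K *v v + u, v) \<partial>lborel)"
      by (rule nn_integral_lborel_translation[symmetric]) (rule measurable_Pair2_borel[OF d])
    also have "\<dots> = (\<integral>\<^sup>+u. ?d (u, 0) * ennreal (exp (- (v \<bullet> (matrix_inv Cvv *v v)) / 2)) \<partial>lborel)"
      unfolding block_complete_square_snd[OF C]
      by (simp only: ennreal_exp_add_half)
    also have "\<dots> = ?c * ennreal (exp (- (v \<bullet> (matrix_inv Cvv *v v)) / 2))"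
      by (rule nn_integral_multc) (use measurable_Pair2_borel[OF d] in simp)
    finally show ?thesis .
  qed
  then have eq: "(\<lambda>v. \<integral>\<^sup>+u. ?d (u, v) \<partial>lborel) =
      (\<lambda>v. ?c * ennreal (exp (- (v \<bullet> (matrix_inv Cvv *v v)) / 2)))"
    by (rule ext)
  show "marginal_v (gaussian_prod ?C) =
      density lborel (\<lambda>v. ?c * ennreal (exp (- (v \<bullet> (matrix_inv Cvv *v v)) / 2)))"
    unfolding marginal_v_def gaussian_prod_density by (subst distr_snd_density[OF d]) (simp only: eq)
qed

lemma bilinear_eq_inner_matrix:
  "u \<bullet> (D *v v) = (\<Sum>i\<in>UNIV. \<Sum>j\<in>UNIV. D $ i $ j * (u $ i * (v :: real^'n) $ j))"
  by (simp add: inner_vec_def matrix_vector_mult_def sum_distrib_left ac_simps)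

text \<open>The inner product of matrices is the Frobenius product. This mean is the linear term of
  both losses and, under the model, the mean to which Jensen's inequality is applied.\<close>

lemma gaussian_prod_bilinear:
  fixes D Cuv :: "real^'n::finite^'m::finite"
  assumes C: "pos_def (block_matrix Cuu Cuv Cvu Cvv)"
  defines "M \<equiv> gaussian_prod (block_matrix Cuu Cuv Cvu Cvv)"
  shows "integrable M (\<lambda>z. fst z \<bullet> (D *v snd z))"
    and "(\<integral>z. fst z \<bullet> (D *v snd z) \<partial>M) = D \<bullet> Cuv"
proof -
  have *: "fst (split_vec x) $ i * snd (split_vec x) $ j = x $ Inl i * x $ Inr j" for x :: "real^('m+'n)" and i j
    by (simp add: split_vec_def)
  have m: "(\<lambda>z. fst z \<bullet> (D *v snd z)) \<in> borel_measurable borel"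
    by measurable
  have eq: "fst (split_vec x) \<bullet> (D *v snd (split_vec x)) =
      (\<Sum>i\<in>UNIV. \<Sum>j\<in>UNIV. D $ i $ j * (x $ Inl i * x $ Inr j))" for x
    unfolding bilinear_eq_inner_matrix * ..
  show "integrable M (\<lambda>z. fst z \<bullet> (D *v snd z))"
    unfolding M_def gaussian_prod_def using m
    by (subst integrable_distr_eq)
      (auto simp: eq intro!: Bochner_Integration.integrable_sum gaussian_second_moment[OF C])
  have "(\<integral>z. fst z \<bullet> (D *v snd z) \<partial>M) =
      (\<integral>x. fst (split_vec x) \<bullet> (D *v snd (split_vec x)) \<partial>gaussian (block_matrix Cuu Cuv Cvu Cvv))"
    unfolding M_def gaussian_prod_def using m by (subst integral_distr) auto
  also have "\<dots> = (\<Sum>i\<in>UNIV. \<Sum>j\<in>UNIV. D $ i $ j * Cuv $ i $ j)"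
    unfolding eq by (simp add: gaussian_second_moment[OF C])
  finally show "(\<integral>z. fst z \<bullet> (D *v snd z) \<partial>M) = D \<bullet> Cuv"
    by (simp add: inner_vec_def)
qed

section \<open>The model\<close>

text \<open>\<open>P\<close> is the precision matrix of the model, since the tilt by
  \<open>u \<bullet> (A *v v)\<close> adds the off-diagonal blocks \<open>- A\<close>.
  \<open>G\<close> inverts the Schur complement of the v-block; in the block inverse it is the
  covariance of \<open>u\<close>, and \<open>G ** A ** Cvv\<close> is the cross-covariance.\<close>

lemma pos_def_precision:
  fixes Cuu G :: "real^'m::finite^'m" and Cvv :: "real^'n::finite^'n" and A :: "real^'n^'m"
  assumes u: "pos_def Cuu" and v: "pos_def Cvv" and G: "pos_def G"
    and inv: "G ** (matrix_inv Cuu - A ** Cvv ** transpose A) = mat 1"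
  defines "P \<equiv> block_matrix (matrix_inv Cuu) (- A) (- transpose A) (matrix_inv Cvv)"
  shows "pos_def P"
    and "matrix_inv P = block_matrix G (G ** A ** Cvv) (Cvv ** transpose A ** G)
      (Cvv + Cvv ** transpose A ** G ** A ** Cvv)"
proof -
  let ?H = "matrix_inv Cuu - A ** Cvv ** transpose A"
  note iv = matrix_inv_mult[OF pos_def_invertible[OF v]]
  have GH: "matrix_inv G = ?H" by (rule matrix_inv_eqI[OF inv])
  have H: "pos_def ?H" using pos_def_matrix_inv[OF G] GH by simp
  have inv': "?H ** G = mat 1" using GH matrix_inv_mult[OF pos_def_invertible[OF G]] by simp
  show "pos_def P"
    unfolding P_def
  proof (rule pos_def_block_matrixI)
    fix a :: "real^'m" and b :: "real^'n" assume ab: "a \<noteq> 0 \<or> b \<noteq> 0"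
    \<comment> \<open>For fixed \<open>a\<close> the quadratic form of \<open>P\<close> is smallest
      at \<open>b = Cvv *v (transpose A *v a)\<close>; \<open>w\<close> measures the deviation, and
      the form becomes the Schur complement in \<open>a\<close> plus a positive form in
      \<open>w\<close>.\<close>
    define w where "w = b - Cvv *v (transpose A *v a)"
    have b: "b = Cvv *v (transpose A *v a) + w" by (simp add: w_def)
    have 1: "matrix_inv Cvv *v b = transpose A *v a + matrix_inv Cvv *v w"
      unfolding b by (simp add: matrix_vector_right_distrib matrix_vector_mul_assoc iv matrix_mul_assoc)
    have 2: "a \<bullet> (A *v b) = (transpose A *v a) \<bullet> (Cvv *v (transpose A *v a)) + (transpose A *v a) \<bullet> w"
      by (subst inner_matrix_vector_right) (simp add: b inner_add_right)
    have 3: "b \<bullet> (transpose A *v a) = a \<bullet> (A *v b)"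
      by (subst inner_matrix_vector_right[of a]) (simp add: inner_commute)
    have 4: "b \<bullet> (matrix_inv Cvv *v w) = (transpose A *v a) \<bullet> w + w \<bullet> (matrix_inv Cvv *v w)"
    proof -
      have "(Cvv *v (transpose A *v a)) \<bullet> (matrix_inv Cvv *v w) = (matrix_inv Cvv *v (Cvv *v (transpose A *v a))) \<bullet> w"
        using pos_def_sym[OF pos_def_matrix_inv[OF v]] by (simp add: inner_matrix_vector_right)
      then show ?thesis
        unfolding b by (simp add: inner_add_left matrix_vector_mul_assoc iv matrix_mul_assoc)
    qed
    have 5: "a \<bullet> (?H *v a) = a \<bullet> (matrix_inv Cuu *v a) - (transpose A *v a) \<bullet> (Cvv *v (transpose A *v a))"
      by (simp add: matrix_vector_mult_diff_rdistrib inner_diff_right inner_matrix_vector_right[of a A]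
          flip: matrix_vector_mul_assoc)
    have "a \<bullet> (matrix_inv Cuu *v a) + a \<bullet> (- A *v b) + b \<bullet> (- transpose A *v a) + b \<bullet> (matrix_inv Cvv *v b)
        = a \<bullet> (?H *v a) + w \<bullet> (matrix_inv Cvv *v w)"
      unfolding 1 inner_add_right 4 5 matrix_vector_minus_left inner_minus_right 3 2 by simp
    also have "\<dots> > 0"
    proof (cases "a = 0")
      case True
      then have "w \<noteq> 0" using ab by (simp add: w_def)
      then show ?thesis using True pos_def_matrix_inv[OF v] by (simp add: pos_def_def)
    next
      case False
      then show ?thesis
        using H pos_def_nonneg[OF pos_def_matrix_inv[OF v]] by (simp add: pos_def_def add_pos_nonneg)
    qed
    finally show "0 < a \<bullet> (matrix_inv Cuu *v a) + a \<bullet> (- A *v b) + b \<bullet> (- transpose A *v a) + b \<bullet> (matrix_inv Cvv *v b)" .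
  qed (use pos_def_sym[OF pos_def_matrix_inv[OF u]] pos_def_sym[OF pos_def_matrix_inv[OF v]]
      in \<open>simp_all add: transpose_minus\<close>)
  show "matrix_inv P = block_matrix G (G ** A ** Cvv) (Cvv ** transpose A ** G)
      (Cvv + Cvv ** transpose A ** G ** A ** Cvv)"
  proof (rule matrix_inv_eqI)
    have 1: "matrix_inv Cuu ** G - A ** Cvv ** transpose A ** G = mat 1"
      using inv' by (simp add: matrix_diff_rdistrib)
    have 2: "matrix_inv Cuu ** (G ** A ** Cvv) - A ** (Cvv + Cvv ** transpose A ** G ** A ** Cvv) = 0"
    proof -
      have "matrix_inv Cuu ** (G ** A ** Cvv) - A ** (Cvv + Cvv ** transpose A ** G ** A ** Cvv) =
          (matrix_inv Cuu ** G - A ** Cvv ** transpose A ** G) ** (A ** Cvv) - A ** Cvv"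
        by (simp add: matrix_diff_rdistrib matrix_add_ldistrib matrix_mul_assoc)
      then show ?thesis by (simp add: 1)
    qed
    show "P ** block_matrix G (G ** A ** Cvv) (Cvv ** transpose A ** G)
        (Cvv + Cvv ** transpose A ** G ** A ** Cvv) = mat 1"
      unfolding P_def block_matrix_mult block_matrix_1[symmetric] block_matrix_eq_iff
      using 1 2 by (simp add: matrix_minus_left matrix_mul_assoc iv matrix_add_ldistrib)
  qed
qed

lemma pair_gaussian_density:
  fixes Cu :: "real^'m::finite^'m" and Cv :: "real^'n::finite^'n"
  assumes "pos_def Cu" "pos_def Cv"
  shows "gaussian Cu \<Otimes>\<^sub>M gaussian Cv = density lborel (\<lambda>(u, v).
      ennreal (exp (- (u \<bullet> (matrix_inv Cu *v u)) / 2) / sqrt ((2 * pi) ^ CARD('m) * det Cu)) *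
      ennreal (exp (- (v \<bullet> (matrix_inv Cv *v v)) / 2) / sqrt ((2 * pi) ^ CARD('n) * det Cv)))"
  using prob_space_imp_sigma_finite[OF prob_space_gaussian[OF assms(2)]]
  unfolding gaussian_def lborel_prod[symmetric]
  by (intro pair_measure_density) (auto intro: sigma_finite_lborel)

text \<open>The two marginal densities times the tilt equal \<open>k\<close> times the exponential
  of the quadratic form of \<open>P\<close>. As the Gaussian with precision \<open>P\<close> has
  mass 1, \<open>Z\<close> is \<open>k\<close> times its normalizing factor \<open>?s\<close>, in
  particular positive and finite.\<close>

lemma
  fixes Cu :: "real^'m::finite^'m" and Cv :: "real^'n::finite^'n" and A :: "real^'n^'m"
  defines "P \<equiv> block_matrix (matrix_inv Cu) (- A) (- transpose A) (matrix_inv Cv)"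
  assumes u: "pos_def Cu" and v: "pos_def Cv" and P: "pos_def P"
    and mu: "marginal_u \<mu> = gaussian Cu" and mv: "marginal_v \<mu> = gaussian Cv"
  shows exp_moment_finite: "exp_moment \<mu> A \<noteq> 0" "exp_moment \<mu> A \<noteq> \<infinity>"
    and model_eq_gaussian_prod: "model \<mu> A = gaussian_prod (matrix_inv P)"
proof -
  let ?su = "sqrt ((2 * pi) ^ CARD('m) * det Cu)"
  let ?sv = "sqrt ((2 * pi) ^ CARD('n) * det Cv)"
  let ?s = "sqrt ((2 * pi) ^ CARD('m + 'n) * det (matrix_inv P))"
  let ?du = "\<lambda>u. exp (- (u \<bullet> (matrix_inv Cu *v u)) / 2) / ?su"
  let ?dv = "\<lambda>v. exp (- (v \<bullet> (matrix_inv Cv *v v)) / 2) / ?sv"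
  let ?e = "\<lambda>z. exp (- (join_vec z \<bullet> (P *v join_vec z)) / 2)"
  define k where "k = 1 / (?su * ?sv)"
  have k: "k > 0" using det_pos_def[OF u] det_pos_def[OF v] by (simp add: k_def)
  have iP: "matrix_inv (matrix_inv P) = P"
    by (rule matrix_inv_matrix_inv[OF pos_def_invertible[OF P]])
  have s: "?s > 0" using det_pos_def[OF pos_def_matrix_inv[OF P]] by simp
  have "?du u * ?dv v * exp (u \<bullet> (A *v v)) = k * ?e (u, v)" for u v
  proof -
    have "v \<bullet> (transpose A *v u) = u \<bullet> (A *v v)"
      by (simp add: inner_matrix_vector_right[of u] inner_commute)
    then have "- (join_vec (u, v) \<bullet> (P *v join_vec (u, v))) / 2 =
        - (u \<bullet> (matrix_inv Cu *v u)) / 2 + - (v \<bullet> (matrix_inv Cv *v v)) / 2 + u \<bullet> (A *v v)"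
      unfolding P_def block_quadratic_form matrix_vector_minus_left inner_minus_right
      by (simp add: field_simps)
    then show ?thesis
      by (simp only: exp_add k_def times_divide_eq_left times_divide_eq_right divide_divide_eq_left mult_1)
  qed
  then have split: "ennreal (?du u) * ennreal (?dv v) * ennreal (exp (u \<bullet> (A *v v))) = ennreal k * ennreal (?e (u, v))" for u v
    using k det_pos_def[OF u] det_pos_def[OF v] by (simp flip: ennreal_mult)
  have [measurable]: "(\<lambda>(u, v). ennreal (?du u) * ennreal (?dv v)) \<in> borel_measurable borel"
    "(\<lambda>(u, v). ennreal (exp (u \<bullet> (A *v v)))) \<in> borel_measurable borel"
    unfolding case_prod_beta by measurable
  have N: "gaussian Cu \<Otimes>\<^sub>M gaussian Cv = density lborel (\<lambda>(u, v). ennreal (?du u) * ennreal (?dv v))"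
    by (rule pair_gaussian_density[OF u v])
  have "(\<integral>\<^sup>+z. ennreal (?e z / ?s) \<partial>lborel) = 1"
    using prob_space.emeasure_space_1[OF prob_space_gaussian_prod[OF pos_def_matrix_inv[OF P]]]
    unfolding gaussian_prod_density iP by (simp add: emeasure_density)
  then have "1 = (\<integral>\<^sup>+z. ennreal (1 / ?s) * ennreal (?e z) \<partial>lborel)"
    using s by (simp flip: ennreal_mult')
  then have Ie: "ennreal (1 / ?s) * (\<integral>\<^sup>+z. ennreal (?e z) \<partial>lborel) = 1"
    by (subst (asm) nn_integral_cmult) auto
  \<comment> \<open>Multiplying by \<open>?s\<close> and its reciprocal solves the mass equation for
    the integral without assuming that it is finite.\<close>
  have "(\<integral>\<^sup>+z. ennreal (?e z) \<partial>lborel) = ennreal ?s * (ennreal (1 / ?s) * (\<integral>\<^sup>+z. ennreal (?e z) \<partial>lborel))"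
    using s by (subst mult.assoc[symmetric], subst ennreal_mult[symmetric]) auto
  then have I: "(\<integral>\<^sup>+z. ennreal (?e z) \<partial>lborel) = ennreal ?s" by (simp only: Ie mult_1_right)
  have "exp_moment \<mu> A = (\<integral>\<^sup>+z. ennreal k * ennreal (?e z) \<partial>lborel)"
    unfolding exp_moment_def mu mv N
    by (subst nn_integral_density) (auto simp: case_prod_beta split[of "fst _" "snd _", simplified] intro!: nn_integral_cong)
  also have "\<dots> = ennreal k * ennreal ?s"
    by (subst nn_integral_cmult) (simp_all only: I, measurable)
  also have "\<dots> = ennreal (k * ?s)" using k s by (simp add: ennreal_mult)
  finally have Z: "exp_moment \<mu> A = ennreal (k * ?s)" .
  have ks: "k * ?s > 0" using k s by simp
  show Z0: "exp_moment \<mu> A \<noteq> 0" "exp_moment \<mu> A \<noteq> \<infinity>"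
    unfolding Z using ks by auto
  have quot: "ennreal (?du u) * ennreal (?dv v) * (ennreal (exp (u \<bullet> (A *v v))) / exp_moment \<mu> A) =
      ennreal k / exp_moment \<mu> A * ennreal (?e (u, v))" for u v
    by (simp only: ennreal_divide_times ennreal_times_divide split)
  have "model \<mu> A = density lborel (\<lambda>z. (case z of (u, v) \<Rightarrow> ennreal (?du u) * ennreal (?dv v)) *
      (case z of (u, v) \<Rightarrow> ennreal (exp (u \<bullet> (A *v v))) / exp_moment \<mu> A))"
    unfolding model_def mu mv N by (subst density_density_eq) (auto simp: case_prod_beta)
  also have "\<dots> = density lborel (\<lambda>z. ennreal k / exp_moment \<mu> A * ennreal (?e z))"
    by (rule arg_cong[where f = "density lborel"]) (simp only: fun_eq_iff split_paired_All prod.case quot simp_thms)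
  finally have m: "model \<mu> A = density lborel (\<lambda>z. ennreal k / exp_moment \<mu> A * ennreal (?e z))" .
  show "model \<mu> A = gaussian_prod (matrix_inv P)"
  proof (rule gaussian_prod_eqI)
    show "prob_space (model \<mu> A)"
    proof (rule prob_spaceI)
      have "emeasure (model \<mu> A) (space (model \<mu> A)) = (\<integral>\<^sup>+z. ennreal k / exp_moment \<mu> A * ennreal (?e z) \<partial>lborel)"
        unfolding m by (simp add: emeasure_density)
      also have "\<dots> = ennreal k / exp_moment \<mu> A * ennreal ?s"
        by (subst nn_integral_cmult) (simp_all only: I, measurable)
      also have "\<dots> = 1"
        using k det_pos_def[OF pos_def_matrix_inv[OF P]] unfolding Z by (simp add: divide_ennreal flip: ennreal_mult)
      finally show "emeasure (model \<mu> A) (space (model \<mu> A)) = 1" .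
    qed
  qed (use pos_def_matrix_inv[OF P] m in \<open>auto simp: iP\<close>)
qed

section \<open>Exponential moments\<close>

text \<open>Exponential tilting by \<open>b\<close> only moves the mean to \<open>C *v b\<close>:
  after translation by that vector the integrand is the original density times the claimed
  value.\<close>

lemma gaussian_mgf:
  fixes C :: "real^'n^'n"
  assumes C: "pos_def C"
  shows "(\<integral>x. exp (b \<bullet> x) \<partial>gaussian C) = exp (b \<bullet> (C *v b) / 2)"
proof -
  let ?s = "sqrt ((2 * pi) ^ CARD('n) * det C)"
  let ?d = "\<lambda>x. ennreal (exp (- (x \<bullet> (matrix_inv C *v x)) / 2) / ?s)"
  note inv = matrix_inv_mult[OF pos_def_invertible[OF C]]
  have s: "?s > 0" using det_pos_def[OF C] by simp
  have q: "(C *v b + x) \<bullet> (matrix_inv C *v (C *v b + x)) = b \<bullet> (C *v b) + 2 * (b \<bullet> x) + x \<bullet> (matrix_inv C *v x)" for x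
    by (simp add: quadratic_form_add[OF pos_def_sym[OF pos_def_matrix_inv[OF C]]] matrix_vector_mul_assoc inv)
      (simp add: inner_commute)
  have "?d (C *v b + x) * ennreal (exp (b \<bullet> (C *v b + x))) = ennreal (exp (b \<bullet> (C *v b) / 2)) * ?d x" for x
  proof -
    have "- (b \<bullet> (C *v b) + 2 * (b \<bullet> x) + x \<bullet> (matrix_inv C *v x)) / 2 + b \<bullet> (C *v b + x) =
        b \<bullet> (C *v b) / 2 + - (x \<bullet> (matrix_inv C *v x)) / 2"
      by (simp add: inner_add_right field_simps)
    then have "exp (- (b \<bullet> (C *v b) + 2 * (b \<bullet> x) + x \<bullet> (matrix_inv C *v x)) / 2) / ?s * exp (b \<bullet> (C *v b + x)) =
        exp (b \<bullet> (C *v b) / 2) * (exp (- (x \<bullet> (matrix_inv C *v x)) / 2) / ?s)"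
      by (simp only: times_divide_eq_left times_divide_eq_right flip: exp_add)
    then show ?thesis
      unfolding q using s by (simp only: ennreal_mult'[symmetric] ennreal_mult''[symmetric] exp_ge_zero)
  qed
  note shift = this
  have I: "(\<integral>\<^sup>+x. ?d x \<partial>lborel) = 1"
    using prob_space.emeasure_space_1[OF prob_space_gaussian[OF C]]
    unfolding gaussian_def by (simp add: emeasure_density)
  have "(\<integral>\<^sup>+x. ennreal (exp (b \<bullet> x)) \<partial>gaussian C) = (\<integral>\<^sup>+x. ?d x * ennreal (exp (b \<bullet> x)) \<partial>lborel)"
    unfolding gaussian_def by (subst nn_integral_density) auto
  also have "\<dots> = (\<integral>\<^sup>+x. ?d (C *v b + x) * ennreal (exp (b \<bullet> (C *v b + x))) \<partial>lborel)"
    by (rule nn_integral_lborel_translation[symmetric]) measurable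
  also have "\<dots> = ennreal (exp (b \<bullet> (C *v b) / 2)) * (\<integral>\<^sup>+x. ?d x \<partial>lborel)"
    unfolding shift by (rule nn_integral_cmult) measurable
  finally have "(\<integral>\<^sup>+x. ennreal (exp (b \<bullet> x)) \<partial>gaussian C) = ennreal (exp (b \<bullet> (C *v b) / 2))"
    unfolding I by simp
  then show ?thesis
    by (subst integral_eq_nn_integral) auto
qed

text \<open>Squaring the weak inequality at \<open>x / 2\<close> gives an extra term
  \<open>x\<^sup>2 / 4\<close>, which makes it strict; if \<open>1 + x / 2\<close> is negative, so
  is \<open>1 + x\<close>.\<close>

lemma exp_gt_add_one:
  fixes x :: real
  assumes "x \<noteq> 0"
  shows "1 + x < exp x"
proof -
  have "1 + x < (1 + x / 2)\<^sup>2" using assms by (simp add: power2_eq_square algebra_simps) (auto simp: zero_less_mult_iff linorder_neq_iff)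
  show ?thesis
  proof (cases "1 + x / 2 \<ge> 0")
    case True
    have "1 + x < (1 + x / 2)\<^sup>2" by fact
    also have "\<dots> \<le> (exp (x / 2))\<^sup>2" using True by (intro power_mono exp_ge_add_one_self)
    also have "\<dots> = exp x" by (simp flip: exp_double)
    finally show ?thesis .
  next
    case False
    then have "1 + x < 0" by simp
    then show ?thesis using exp_gt_zero[of x] by linarith
  qed
qed

text \<open>The gap between \<open>exp\<close> and its tangent at the mean is nonnegative and
  vanishes only at the mean. The right-hand side may be infinite, which covers the parameters with
  infinite \<open>Z\<close>.\<close>

lemma strict_Jensen_exp:
  fixes X :: "'a \<Rightarrow> real"
  assumes M: "prob_space M" and X: "integrable M X" and ne: "\<not> (AE x in M. X x = (\<integral>x. X x \<partial>M))"
  shows "ennreal (exp (\<integral>x. X x \<partial>M)) < (\<integral>\<^sup>+x. ennreal (exp (X x)) \<partial>M)"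
proof (cases "(\<integral>\<^sup>+x. ennreal (exp (X x)) \<partial>M) = \<infinity>")
  case False
  interpret prob_space M by fact
  have [measurable]: "X \<in> borel_measurable M" using X by auto
  let ?m = "\<integral>x. X x \<partial>M"
  have e: "integrable M (\<lambda>x. exp (X x))"
    using False by (intro integrableI_nonneg) (auto simp: less_top)
  define f where "f x = exp (X x) - exp ?m * (1 + (X x - ?m))" for x
  have f: "integrable M f" unfolding f_def using e X by auto
  have eq: "exp (X x) = exp ?m * exp (X x - ?m)" for x by (simp flip: exp_add)
  have f0: "f x \<ge> 0" for x
    unfolding f_def using exp_ge_add_one_self[of "X x - ?m"] by (simp add: eq[of x] mult_left_mono)
  have f_eq: "f x = 0 \<longleftrightarrow> X x = ?m" for x
  proof (cases "X x = ?m")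
    case False
    then have "exp ?m * (1 + (X x - ?m)) < exp ?m * exp (X x - ?m)"
      using exp_gt_add_one[of "X x - ?m"] by simp
    then show ?thesis using False by (simp add: f_def eq[of x])
  qed (simp add: f_def)
  have "\<not> (AE x in M. f x = 0)" using ne by (simp add: f_eq)
  then have "(\<integral>x. f x \<partial>M) \<noteq> 0"
    using integral_nonneg_eq_0_iff_AE[OF f] f0 by simp
  moreover have "(\<integral>x. f x \<partial>M) \<ge> 0" using f0 by (simp add: Bochner_Integration.integral_nonneg)
  moreover have "(\<integral>x. f x \<partial>M) = (\<integral>x. exp (X x) \<partial>M) - exp ?m"
    unfolding f_def using e X by (simp add: prob_space)
  ultimately have "exp ?m < (\<integral>x. exp (X x) \<partial>M)" by linarith
  moreover have "(\<integral>\<^sup>+x. ennreal (exp (X x)) \<partial>M) = ennreal (\<integral>x. exp (X x) \<partial>M)"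
    using e by (intro nn_integral_eq_integral) auto
  ultimately show ?thesis by (simp add: ennreal_lessI less_trans[OF exp_gt_zero])
qed simp

text \<open>The exceptional set is open, and a nonempty open set is not null.\<close>

lemma AE_lborel_continuous_eq:
  fixes f :: "'a::euclidean_space \<Rightarrow> real"
  assumes f: "continuous_on UNIV f" and "AE x in lborel. f x = c"
  shows "f x = c"
proof (rule ccontr)
  assume "f x \<noteq> c"
  let ?S = "{x. f x \<noteq> c}"
  have "open ?S" using open_Collect_neq[OF f continuous_on_const] by simp
  moreover have "?S \<noteq> {}" using \<open>f x \<noteq> c\<close> by auto
  ultimately have "\<not> negligible ?S" by (rule open_not_negligible)
  moreover have "?S \<in> null_sets lborel"
    using \<open>open ?S\<close> assms(2) by (subst (asm) AE_iff_null) auto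
  ultimately show False
    by (simp add: negligible_iff_null_sets null_sets_completionI)
qed

text \<open>Provides the strictness in Jensen's inequality, hence uniqueness of the joint minimizer.
  The Gaussian density is positive, so almost everywhere becomes everywhere by continuity; pairs of
  axis vectors then read off the entries of \<open>D\<close>.\<close>

lemma gaussian_prod_bilinear_not_AE_const:
  fixes D :: "real^'n::finite^'m::finite"
  assumes C: "pos_def C" and D: "D \<noteq> 0"
  shows "\<not> (AE z in gaussian_prod C. fst z \<bullet> (D *v snd z) = c)"
proof
  assume "AE z in gaussian_prod C. fst z \<bullet> (D *v snd z) = c"
  then have "AE z in lborel. fst z \<bullet> (D *v snd z) = c"
    unfolding gaussian_prod_density using det_pos_def[OF C]
    by (subst (asm) AE_density) auto
  then have const: "fst z \<bullet> (D *v snd z) = c" for z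
  proof (rule AE_lborel_continuous_eq[rotated])
    have "continuous_on UNIV ((*v) D)"
      by (intro linear_continuous_on linear_linear[THEN iffD2] matrix_vector_mul_linear)
    then have "continuous_on UNIV (\<lambda>z. D *v snd (z :: (real^'m) \<times> (real^'n)))"
      by (rule continuous_on_compose2) (auto intro: continuous_intros)
    then show "continuous_on UNIV (\<lambda>z. fst z \<bullet> (D *v snd z))"
      by (intro continuous_intros)
  qed
  have "c = 0" using const[of "(0, 0)"] by simp
  then have "D $ i $ j = 0" for i j
    using const[of "(axis i 1, axis j 1)"] by (simp add: inner_axis' matrix_vector_mult_basis column_def)
  with D show False by (simp add: vec_eq_iff)
qed

section \<open>Minimizers of the losses\<close>

text \<open>Under \<open>model \<mu> A0\<close>, the expectation of \<open>exp \<langle>u, (A - A0) v\<rangle>\<close> is \<open>Z(A) / Z(A0)\<close>; once the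
  cross-covariances match, Jensen's inequality for it is the minimality of \<open>A0\<close>.\<close>

lemma joint_loss_less:
  fixes A A0 :: "real^'n::finite^'m::finite"
  assumes mu: "\<mu> = gaussian_prod (block_matrix Cuu Cuv Cvu Cvv)" and C: "pos_def (block_matrix Cuu Cuv Cvu Cvv)"
    and model: "model \<mu> A0 = gaussian_prod (block_matrix Guu Cuv Gvu Gvv)"
    and G: "pos_def (block_matrix Guu Cuv Gvu Gvv)"
    and Z: "exp_moment \<mu> A0 \<noteq> 0" "exp_moment \<mu> A0 \<noteq> \<infinity>" and ne: "A \<noteq> A0"
  shows "joint_loss \<mu> A0 < joint_loss \<mu> A"
proof -
  let ?N = "marginal_u \<mu> \<Otimes>\<^sub>M marginal_v \<mu>"
  let ?X = "\<lambda>z. fst z \<bullet> ((A - A0) *v snd z)"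
  have lin: "(\<integral>(u, v). u \<bullet> (B *v v) \<partial>\<mu>) = B \<bullet> Cuv" for B :: "real^'n^'m"
    using gaussian_prod_bilinear(2)[OF C, of B] by (simp add: mu case_prod_unfold)
  note X = gaussian_prod_bilinear[OF G, of "A - A0"]
  have sets [measurable_cong]: "sets ?N = sets borel"
    by (subst borel_prod[symmetric], rule sets_pair_measure_cong) (simp_all add: marginal_u_def marginal_v_def)
  have m [measurable]: "(\<lambda>(u, v). ennreal (exp (u \<bullet> (B *v v)))) \<in> borel_measurable ?N" for B :: "real^'n^'m"
    unfolding measurable_cong_sets[OF sets refl] case_prod_beta by measurable
  have pt: "(case z of (u, v) \<Rightarrow> ennreal (exp (u \<bullet> (A0 *v v))) / exp_moment \<mu> A0) * ennreal (exp (?X z)) =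
      (case z of (u, v) \<Rightarrow> ennreal (exp (u \<bullet> (A *v v)))) / exp_moment \<mu> A0" for z
    by (cases z) (simp add: ennreal_divide_times ennreal_times_divide exp_diff inner_diff_right matrix_vector_mult_diff_rdistrib
        flip: ennreal_mult)
  have "(\<integral>\<^sup>+z. ennreal (exp (?X z)) \<partial>model \<mu> A0) =
      (\<integral>\<^sup>+z. (case z of (u, v) \<Rightarrow> ennreal (exp (u \<bullet> (A *v v)))) / exp_moment \<mu> A0 \<partial>?N)"
    unfolding model_def
    by (subst nn_integral_density) (simp_all only: pt, auto simp: case_prod_beta)
  also have "\<dots> = exp_moment \<mu> A / exp_moment \<mu> A0"
    unfolding exp_moment_def by (subst nn_integral_divide) (auto simp: case_prod_beta)
  finally have E: "(\<integral>\<^sup>+z. ennreal (exp (?X z)) \<partial>model \<mu> A0) = exp_moment \<mu> A / exp_moment \<mu> A0" .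
  have "ennreal (exp ((A - A0) \<bullet> Cuv)) < (\<integral>\<^sup>+z. ennreal (exp (?X z)) \<partial>model \<mu> A0)"
    using strict_Jensen_exp[OF prob_space_gaussian_prod[OF G] X(1)]
      gaussian_prod_bilinear_not_AE_const[OF G] ne unfolding X(2) model by simp
  then have less: "ennreal (exp ((A - A0) \<bullet> Cuv)) < exp_moment \<mu> A / exp_moment \<mu> A0"
    by (simp only: E)
  obtain z0 where z0: "exp_moment \<mu> A0 = ennreal z0" "z0 > 0"
    using Z by (cases "exp_moment \<mu> A0") (auto simp: less_le)
  show ?thesis
  proof (cases "exp_moment \<mu> A")
    case (real z)
    have "z \<noteq> 0" using less real by auto
    then have z: "z > 0" using real by simp
    have "ennreal (exp ((A - A0) \<bullet> Cuv)) < ennreal (z / z0)"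
      using less real z0 z by (simp add: divide_ennreal)
    then have "exp ((A - A0) \<bullet> Cuv) < z / z0"
      by (metis ennreal_less_iff exp_ge_zero)
    then have "(A - A0) \<bullet> Cuv < ln (z / z0)"
      using z z0 by (metis divide_pos_pos exp_less_cancel_iff exp_ln)
    then show ?thesis
      using z z0 real by (simp add: joint_loss_def lin ext_ln_def ln_div inner_diff_left)
  next
    \<comment> \<open>Here the loss of \<open>A\<close> is \<infinity>, while that of
      \<open>A0\<close> is finite.\<close>
    case top
    then show ?thesis using z0 by (simp add: joint_loss_def ext_ln_def)
  qed
qed

section \<open>Frobenius adjoints and the conditional loss\<close>

lemma inner_matrix_mult_left: "(X ** Y) \<bullet> Z = Y \<bullet> (transpose X ** (Z :: real^'n^'m))"
proof -
  have "(X ** Y) \<bullet> Z = (\<Sum>i\<in>UNIV. \<Sum>j\<in>UNIV. \<Sum>k\<in>UNIV. X $ i $ k * Y $ k $ j * Z $ i $ j)"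
    by (simp add: inner_vec_def matrix_matrix_mult_def sum_distrib_right)
  also have "\<dots> = (\<Sum>k\<in>UNIV. \<Sum>j\<in>UNIV. \<Sum>i\<in>UNIV. X $ i $ k * Y $ k $ j * Z $ i $ j)"
    by (subst sum.swap, subst (2) sum.swap, subst sum.swap) (rule refl)
  also have "\<dots> = Y \<bullet> (transpose X ** Z)"
    by (simp add: inner_vec_def matrix_matrix_mult_def sum_distrib_left transpose_def ac_simps)
  finally show ?thesis .
qed

lemma inner_transpose: "transpose X \<bullet> transpose Y = X \<bullet> (Y :: real^'n^'m)"
  unfolding inner_vec_def transpose_def by (simp add: inner_vec_def) (rule sum.swap)

lemma inner_matrix_mult_right: "(X ** Y) \<bullet> Z = X \<bullet> (Z ** transpose (Y :: real^'n^'m))"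
proof -
  have "(X ** Y) \<bullet> Z = (transpose Y ** transpose X) \<bullet> transpose Z"
    by (simp only: inner_transpose flip: matrix_transpose_mul)
  also have "\<dots> = transpose X \<bullet> transpose (Z ** transpose Y)"
    by (simp only: inner_matrix_mult_left matrix_transpose_mul transpose_transpose)
  finally show ?thesis by (simp only: inner_transpose)
qed

text \<open>By \<open>gaussian_mgf\<close> both inner logarithms are quadratic forms. Their Gaussian
  means are the same number, the Frobenius product on the right, so the two weights 1/2 combine and
  only the factor 1/2 of the logarithm remains.\<close>

lemma cond_loss_eq:
  fixes A :: "real^'n::finite^'m::finite"
  assumes mu: "\<mu> = gaussian_prod (block_matrix Cuu Cuv Cvu Cvv)" and C: "pos_def (block_matrix Cuu Cuv Cvu Cvv)"
  shows "cond_loss \<mu> A = - (A \<bullet> Cuv) + (Cuu ** A) \<bullet> (A ** Cvv) / 2"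
proof -
  note pd = pos_def_block_matrixD(1,2)[OF C]
  have Mu: "marginal_u \<mu> = gaussian Cuu" and Mv: "marginal_v \<mu> = gaussian Cvv"
    unfolding mu by (rule marginal_u_gaussian_prod[OF C], rule marginal_v_gaussian_prod[OF C])
  have lin: "(\<integral>(u, v). u \<bullet> (A *v v) \<partial>\<mu>) = A \<bullet> Cuv"
    using gaussian_prod_bilinear(2)[OF C, of A] by (simp add: mu case_prod_unfold)
  have 1: "ln (\<integral>v. exp (u \<bullet> (A *v v)) \<partial>gaussian Cvv) = (u \<bullet> ((A ** Cvv ** transpose A) *v u)) / 2" for u
  proof -
    have "ln (\<integral>v. exp (u \<bullet> (A *v v)) \<partial>gaussian Cvv) = (transpose A *v u) \<bullet> (Cvv *v (transpose A *v u)) / 2"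
      by (simp only: inner_matrix_vector_right[of u A] gaussian_mgf[OF pd(2)] ln_exp)
    then show ?thesis
      by (simp only: inner_matrix_vector_right[of u A, symmetric] matrix_vector_mul_assoc matrix_mul_assoc)
  qed
  have 2: "ln (\<integral>u. exp (u \<bullet> (A *v v)) \<partial>gaussian Cuu) = (v \<bullet> ((transpose A ** Cuu ** A) *v v)) / 2" for v
  proof -
    have "ln (\<integral>u. exp (u \<bullet> (A *v v)) \<partial>gaussian Cuu) = (A *v v) \<bullet> (Cuu *v (A *v v)) / 2"
      by (subst inner_commute) (simp only: gaussian_mgf[OF pd(1)] ln_exp)
    then show ?thesis
      by (simp only: inner_matrix_vector_right[of v "transpose A", unfolded transpose_transpose, symmetric]
          matrix_vector_mul_assoc matrix_mul_assoc)
  qed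
  have q: "(\<integral>x. x \<bullet> (Q *v x) \<partial>gaussian B) = Q \<bullet> B" if "pos_def B" for B Q :: "real^'k^'k"
    using gaussian_quadratic_form(2)[OF that] by (simp add: inner_vec_def)
  have "(A ** Cvv ** transpose A) \<bullet> Cuu = (A ** Cvv) \<bullet> (Cuu ** A)"
    by (subst inner_matrix_mult_right) simp
  moreover have "(transpose A ** Cuu ** A) \<bullet> Cvv = (Cuu ** A) \<bullet> (A ** Cvv)"
    by (subst matrix_mul_assoc[symmetric], subst inner_matrix_mult_left) simp
  ultimately show ?thesis
    unfolding cond_loss_def Mu Mv lin 1 2
    by (simp add: q[OF pd(1)] q[OF pd(2)] inner_commute)
qed

text \<open>The condition on \<open>A0\<close> is the vanishing of the gradient: the terms linear in
  \<open>D = A - A0\<close> cancel, and what remains is half the squared norm of \<open>D\<close> in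
  whitened coordinates.\<close>

lemma cond_loss_less:
  fixes A A0 :: "real^'n::finite^'m::finite"
  assumes mu: "\<mu> = gaussian_prod (block_matrix Cuu Cuv Cvu Cvv)" and C: "pos_def (block_matrix Cuu Cuv Cvu Cvv)"
    and A0: "Cuu ** A0 ** Cvv = Cuv" and ne: "A \<noteq> A0"
  shows "cond_loss \<mu> A0 < cond_loss \<mu> A"
proof -
  define D where "D = A - A0"
  have A: "A = A0 + D" and D: "D \<noteq> 0" using ne by (simp_all add: D_def)
  note pd = pos_def_block_matrixD(1,2)[OF C]
  let ?Su = "mat_sqrt Cuu" and ?Sv = "mat_sqrt Cvv"
  have S: "transpose ?Su = ?Su" "transpose ?Sv = ?Sv" "?Su ** ?Su = Cuu" "?Sv ** ?Sv = Cvv"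
    "invertible ?Su" "invertible ?Sv"
    using pd by (simp_all add: pos_def_sym pos_def_invertible pos_def_mat_sqrt mat_sqrt_mult_self)
  have sym: "transpose Cuu = Cuu" "transpose Cvv = Cvv" using pd by (simp_all add: pos_def_sym)
  have 1: "(Cuu ** D) \<bullet> (A0 ** Cvv) = D \<bullet> Cuv"
    by (subst inner_matrix_mult_left) (simp add: sym matrix_mul_assoc A0)
  have 2: "(Cuu ** A0) \<bullet> (D ** Cvv) = D \<bullet> Cuv"
    by (subst inner_commute, subst inner_matrix_mult_right) (simp add: sym A0)
  have 3: "(Cuu ** D) \<bullet> (D ** Cvv) = (?Su ** D ** ?Sv) \<bullet> (?Su ** D ** ?Sv)"
  proof -
    have "(?Su ** D ** ?Sv) \<bullet> (?Su ** D ** ?Sv) = (?Su ** (D ** ?Sv)) \<bullet> (?Su ** D ** ?Sv)"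
      by (simp add: matrix_mul_assoc)
    also have "\<dots> = (D ** ?Sv) \<bullet> (?Su ** (?Su ** D ** ?Sv))"
      by (subst inner_matrix_mult_left) (simp add: S)
    also have "?Su ** (?Su ** D ** ?Sv) = (Cuu ** D) ** ?Sv"
      by (simp add: matrix_mul_assoc S)
    also have "(D ** ?Sv) \<bullet> ((Cuu ** D) ** ?Sv) = ((Cuu ** D) ** ?Sv) \<bullet> (D ** ?Sv)"
      by (rule inner_commute)
    also have "\<dots> = (Cuu ** D) \<bullet> (D ** ?Sv ** ?Sv)"
      by (subst inner_matrix_mult_right) (simp add: S)
    also have "\<dots> = (Cuu ** D) \<bullet> (D ** Cvv)"
      by (simp add: S flip: matrix_mul_assoc)
    finally show ?thesis ..
  qed
  \<comment> \<open>Whitening is injective, which turns the weak minimum into a strict one.\<close>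
  have "?Su ** D ** ?Sv \<noteq> 0"
  proof
    assume "?Su ** D ** ?Sv = 0"
    then have "matrix_inv ?Su ** (?Su ** D ** ?Sv) ** matrix_inv ?Sv = 0" by simp
    moreover have "matrix_inv ?Su ** (?Su ** D ** ?Sv) ** matrix_inv ?Sv =
        (matrix_inv ?Su ** ?Su) ** D ** (?Sv ** matrix_inv ?Sv)"
      by (simp add: matrix_mul_assoc)
    ultimately show False using D S by (simp add: matrix_inv_mult)
  qed
  then have pos: "(?Su ** D ** ?Sv) \<bullet> (?Su ** D ** ?Sv) > 0" by simp
  have "(Cuu ** A) \<bullet> (A ** Cvv) = (Cuu ** A0) \<bullet> (A0 ** Cvv) + 2 * (D \<bullet> Cuv) + (Cuu ** D) \<bullet> (D ** Cvv)"
    unfolding A by (simp add: matrix_add_ldistrib matrix_add_rdistrib inner_add_left inner_add_right 1 2)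
  then show ?thesis
    unfolding cond_loss_eq[OF mu C] 3 using pos by (simp add: A inner_add_left field_simps)
qed

section \<open>Singular values and the two minimizers\<close>

definition diag_mat :: "('n \<Rightarrow> real) \<Rightarrow> real^'n^'n" where
  "diag_mat d = (\<chi> i j. if i = j then d i else 0)"

lemma diag_mat_nth: "diag_mat d $ i $ j = (if i = j then d i else 0)"
  by (simp add: diag_mat_def)

lemma diag_mat_mult_left_nth: "(diag_mat d ** X) $ i $ j = d i * X $ i $ j"
proof -
  have "(diag_mat d ** X) $ i $ j = (\<Sum>k\<in>UNIV. (d i * X $ k $ j) * (if i = k then 1 else 0))"
    unfolding matrix_matrix_mult_def vec_lambda_beta diag_mat_nth by (intro sum.cong) auto
  then show ?thesis by (simp only: sum_mult_delta)
qed

lemma diag_mat_mult_right_nth: "(X ** diag_mat d) $ i $ j = X $ i $ j * d j"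
proof -
  have "(X ** diag_mat d) $ i $ j = (\<Sum>k\<in>UNIV. (X $ i $ k * d j) * (if j = k then 1 else 0))"
    unfolding matrix_matrix_mult_def vec_lambda_beta diag_mat_nth by (intro sum.cong) auto
  then show ?thesis by (simp only: sum_mult_delta)
qed

lemma diag_mat_mult: "diag_mat d ** diag_mat e = diag_mat (\<lambda>i. d i * e i)"
  by (simp add: vec_eq_iff diag_mat_mult_left_nth) (simp add: diag_mat_nth)

lemma diag_mat_mult_vec: "(diag_mat d *v x) $ i = d i * x $ i"
proof -
  have "(diag_mat d *v x) $ i = (\<Sum>k\<in>UNIV. (d i * x $ k) * (if i = k then 1 else 0))"
    unfolding matrix_vector_mult_def vec_lambda_beta diag_mat_nth by (intro sum.cong) auto
  then show ?thesis by (simp only: sum_mult_delta)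
qed

lemma diag_mat_1: "diag_mat (\<lambda>_. 1) = mat 1"
  by (simp add: vec_eq_iff diag_mat_nth mat_def)

lemma transpose_diag_mat: "transpose (diag_mat d) = diag_mat d"
  by (simp add: vec_eq_iff transpose_def diag_mat_nth)

lemma mat_1_minus_diag_mat: "mat 1 - diag_mat d = diag_mat (\<lambda>i. 1 - d i)"
  by (simp add: vec_eq_iff mat_def diag_mat_nth)

lemma matrix_inv_diag_mat:
  assumes "\<And>i. d i \<noteq> 0"
  shows "matrix_inv (diag_mat d) = diag_mat (\<lambda>i. 1 / d i)"
  by (rule matrix_inv_eqI) (simp add: diag_mat_mult assms diag_mat_1)

lemma pos_def_diag_mat:
  assumes "\<And>i. d i > 0"
  shows "pos_def (diag_mat d)"
proof -
  have "x \<bullet> (diag_mat d *v x) > 0" if nz: "x \<noteq> 0" for x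
  proof -
    have eq: "x \<bullet> (diag_mat d *v x) = (\<Sum>i\<in>UNIV. d i * (x $ i)\<^sup>2)"
      by (simp add: inner_vec_def diag_mat_mult_vec power2_eq_square ac_simps)
    obtain i where "x $ i \<noteq> 0" using nz by (metis vec_eq_iff zero_index)
    then show ?thesis
      unfolding eq using assms by (intro sum_pos2[of _ i]) (auto simp: less_imp_le)
  qed
  then show ?thesis by (simp add: pos_def_def transpose_diag_mat)
qed

lemma matrix_mult_eq_assoc: "X ** Y = V \<Longrightarrow> X ** (Y ** Z) = V ** Z"
  by (simp add: matrix_mul_assoc)

section \<open>The function \<open>h\<close> and the variance weights\<close>

lemma h_0 [simp]: "h 0 = 0"
  by (simp add: h_def)

text \<open>\<open>h s\<close> is the positive root of \<open>s * t\<^sup>2 + t - s = 0\<close>. The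
  last claim is this equation, the moment condition for one singular value free of division.\<close>

lemma h_properties:
  assumes "s > 0"
  shows "0 < h s" "h s < s" "h s = s * (1 - (h s)\<^sup>2)"
proof -
  define r where "r = sqrt (1 + 4 * s\<^sup>2)"
  have r2: "r\<^sup>2 = 1 + 4 * s\<^sup>2" by (simp add: r_def)
  have r1: "r > 1" using assms by (simp add: r_def)
  have h: "h s = (r - 1) / (2 * s)" using assms by (simp add: h_def r_def field_simps)
  show "0 < h s" using r1 assms by (simp add: h)
  have "(1 + 4 * s\<^sup>2) < (1 + 2 * s\<^sup>2)\<^sup>2" using assms by (simp add: power2_eq_square algebra_simps)
  then have "r < 1 + 2 * s\<^sup>2" unfolding r_def by (intro real_less_lsqrt) auto
  then show "h s < s" using assms by (simp add: h divide_less_eq power2_eq_square)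
  \<comment> \<open>The equation to be shown, multiplied by \<open>4 * s\<^sup>2\<close>.\<close>
  have "(r - 1) * (2 * s) = s * (4 * s\<^sup>2 - (r - 1)\<^sup>2)"
    using r2 by (simp add: power2_eq_square algebra_simps)
  then show "h s = s * (1 - (h s)\<^sup>2)"
    using assms by (simp add: h field_simps power2_eq_square)
qed

lemma weight_mono:
  assumes "0 \<le> a" "a \<le> b" "b < (1::real)"
  shows "1 / (1 - a\<^sup>2) \<le> 1 / (1 - b\<^sup>2)" and "a < b \<Longrightarrow> 1 / (1 - a\<^sup>2) < 1 / (1 - b\<^sup>2)"
proof -
  have b: "b\<^sup>2 < 1" using assms by (simp add: abs_square_less_1)
  have "a\<^sup>2 \<le> b\<^sup>2" using assms by (intro power_mono)
  then show "1 / (1 - a\<^sup>2) \<le> 1 / (1 - b\<^sup>2)" using b by (intro divide_left_mono) auto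
  assume "a < b"
  then have "a\<^sup>2 < b\<^sup>2" using assms by (intro power_strict_mono) auto
  then show "1 / (1 - a\<^sup>2) < 1 / (1 - b\<^sup>2)" using b by (intro divide_strict_left_mono) auto
qed

text \<open>The singular values are kept as a function \<open>\<sigma>\<close>, so that applying
  \<open>h\<close> to the diagonal is composition and zero entries are handled index by
  index.\<close>

locale gaussian_svd =
  fixes Cuu :: "real^'u::finite^'u" and Cuv :: "real^'v::finite^'u"
    and Cvu :: "real^'u^'v" and Cvv :: "real^'v^'v"
    and U :: "real^'u^'u" and \<sigma> :: "'u \<Rightarrow> real" and W :: "real^'u^'v"
  assumes C: "pos_def (block_matrix Cuu Cuv Cvu Cvv)"
    and U: "orthogonal_matrix U"
    and \<sigma>_nonneg: "\<sigma> i \<ge> 0"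
    and svd: "matrix_inv (mat_sqrt Cuu) ** Cuv ** matrix_inv (mat_sqrt Cvv) = U ** diag_mat \<sigma> ** transpose W"
    and W: "\<sigma> i \<noteq> 0 \<Longrightarrow> \<sigma> j \<noteq> 0 \<Longrightarrow> column i W \<bullet> column j W = (if i = j then 1 else 0)"
begin

abbreviation "Su \<equiv> mat_sqrt Cuu"
abbreviation "Sv \<equiv> mat_sqrt Cvv"
abbreviation "Ru \<equiv> matrix_inv Su"
abbreviation "Rv \<equiv> matrix_inv Sv"
abbreviation "\<mu> \<equiv> gaussian_prod (block_matrix Cuu Cuv Cvu Cvv)"

text \<open>The parameter whose whitened form \<open>Su ** A ** Sv\<close> is
  \<open>U ** diag_mat d ** transpose W\<close>.\<close>

definition coupling :: "('u \<Rightarrow> real) \<Rightarrow> real^'v^'u" where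
  "coupling d = Ru ** U ** diag_mat d ** transpose W ** Rv"

text \<open>Covariance of \<open>u\<close> under the model with parameter \<open>coupling d\<close>;
  at \<open>d = 0\<close> it is \<open>Cuu\<close>, which places the true marginal in the same
  family.\<close>

definition marginal_cov :: "('u \<Rightarrow> real) \<Rightarrow> real^'u^'u" where
  "marginal_cov d = Su ** U ** diag_mat (\<lambda>i. 1 / (1 - (d i)\<^sup>2)) ** transpose U ** Su"

lemma pd: "pos_def Cuu" "pos_def Cvv" "Cvu = transpose Cuv"
  by (rule pos_def_block_matrixD[OF C])+

lemma sqrt_facts:
  "transpose Su = Su" "transpose Sv = Sv" "transpose Ru = Ru" "transpose Rv = Rv"
  "Su ** Su = Cuu" "Sv ** Sv = Cvv" "Su ** Ru = mat 1" "Ru ** Su = mat 1" "Sv ** Rv = mat 1" "Rv ** Sv = mat 1"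
  using pd by (simp_all add: pos_def_sym pos_def_mat_sqrt pos_def_matrix_inv mat_sqrt_mult_self
      matrix_inv_mult pos_def_invertible)

lemma U_facts: "transpose U ** U = mat 1" "U ** transpose U = mat 1"
  using U by (auto simp: orthogonal_matrix_def)

lemma cov_sqrt: "Cuu ** Ru = Su" "Ru ** Cuu = Su" "Cvv ** Rv = Sv" "Rv ** Cvv = Sv"
  by (metis sqrt_facts(5,7) matrix_mul_assoc matrix_mul_rid,
      metis sqrt_facts(5,8) matrix_mul_assoc matrix_mul_lid,
      metis sqrt_facts(6,9) matrix_mul_assoc matrix_mul_rid,
      metis sqrt_facts(6,10) matrix_mul_assoc matrix_mul_lid)

text \<open>Each cancellation also appears with a trailing factor, so that rewriting finds it
  anywhere in a product associated to the right.\<close>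

lemmas cancel0 = sqrt_facts(7-10) U_facts cov_sqrt
lemmas cancel = cancel0 cancel0[THEN matrix_mult_eq_assoc] matrix_mul_lid matrix_mul_rid

lemma Cuu_inv: "matrix_inv Cuu = Ru ** Ru"
proof (rule matrix_inv_eqI)
  show "Cuu ** (Ru ** Ru) = mat 1" by (simp only: cancel)
qed

lemma Cuv_eq: "Cuv = Su ** U ** diag_mat \<sigma> ** transpose W ** Sv"
proof -
  have "Cuv = Su ** (Ru ** Cuv ** Rv) ** Sv"
    by (simp add: cancel matrix_mul_assoc[symmetric])
  then show ?thesis unfolding svd by (simp only: matrix_mul_assoc)
qed

text \<open>The outer diagonal factors kill the arbitrary columns of \<open>W\<close>, so that
  \<open>W\<close> behaves as if all its columns were orthonormal.\<close>

lemma W_gram: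
  assumes "\<And>i. \<sigma> i = 0 \<Longrightarrow> d i = 0" "\<And>i. \<sigma> i = 0 \<Longrightarrow> e i = 0"
  shows "diag_mat d ** (transpose W ** W) ** diag_mat e = diag_mat (\<lambda>i. d i * e i)"
proof -
  have "d i * (column i W \<bullet> column j W) * e j = (if i = j then d i * e i else 0)" for i j
    using assms W[of i j] by (cases "\<sigma> i = 0"; cases "\<sigma> j = 0") auto
  then show ?thesis
    by (simp add: vec_eq_iff diag_mat_mult_left_nth diag_mat_mult_right_nth matrix_mult_transpose_dot_column)
      (simp add: diag_mat_nth)
qed

text \<open>For a pair of singular vectors \<open>a\<close>, \<open>b\<close>, the form of the joint
  covariance at \<open>(Ru *v a, - (Rv *v b))\<close> is \<open>2 - 2 * \<sigma> i\<close>, which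
  has to be positive.\<close>

lemma \<sigma>_less_1: "\<sigma> i < 1"
proof (cases "\<sigma> i = 0")
  case False
  define a where "a = U *v axis i 1"
  define b where "b = column i W"
  have Ua: "transpose U *v a = axis i 1"
    by (simp add: a_def matrix_vector_mul_assoc U_facts)
  then have "a \<noteq> 0" by (metis axis_eq_0_iff matrix_vector_mult_0_right zero_neq_one)
  then have Ra: "Ru *v a \<noteq> 0"
    by (metis matrix_vector_mul_assoc matrix_vector_mul_lid matrix_vector_mult_0_right sqrt_facts(7))
  have aa: "a \<bullet> a = 1"
    unfolding a_def by (simp add: inner_matrix_vector_right[of _ U] matrix_vector_mul_assoc U_facts inner_axis)
  have bb: "b \<bullet> b = 1" using W[OF False False] by (simp add: b_def)
  have Wb: "(transpose W *v b) $ i = 1"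
    using bb by (simp add: matrix_vector_mul_component b_def transpose_def column_def)
  have ab: "a \<bullet> ((Ru ** Cuv ** Rv) *v b) = \<sigma> i"
  proof -
    have "a \<bullet> ((Ru ** Cuv ** Rv) *v b) = (transpose U *v a) \<bullet> (diag_mat \<sigma> *v (transpose W *v b))"
      unfolding svd by (simp only: inner_matrix_vector_right[of a U, symmetric] matrix_vector_mul_assoc matrix_mul_assoc)
    then show ?thesis unfolding Ua by (simp add: inner_axis' diag_mat_mult_vec Wb)
  qed
  let ?p = "Ru *v a" and ?q = "- (Rv *v b)"
  have "0 < join_vec (?p, ?q) \<bullet> (block_matrix Cuu Cuv Cvu Cvv *v join_vec (?p, ?q))"
    using C Ra unfolding pos_def_def by (simp add: join_vec_eq_0_iff)
  also have "\<dots> = ?p \<bullet> (Cuu *v ?p) - 2 * (?p \<bullet> (Cuv *v (Rv *v b))) + (Rv *v b) \<bullet> (Cvv *v (Rv *v b))"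
  proof -
    have "(Rv *v b) \<bullet> (Cvu *v ?p) = ?p \<bullet> (Cuv *v (Rv *v b))"
      unfolding pd(3) inner_matrix_vector_right[of ?p Cuv] by (rule inner_commute)
    then show ?thesis
      by (simp add: block_quadratic_form matrix_vector_minus_right)
  qed
  also have "?p \<bullet> (Cuu *v ?p) = 1"
  proof -
    have "?p \<bullet> (Cuu *v ?p) = ?p \<bullet> (Su *v a)"
      by (simp only: matrix_vector_mul_assoc cancel)
    also have "\<dots> = (Su *v ?p) \<bullet> a"
      by (simp only: inner_matrix_vector_right[of ?p Su a] sqrt_facts(1))
    finally show ?thesis
      by (simp only: matrix_vector_mul_assoc cancel matrix_vector_mul_lid aa)
  qed
  also have "(Rv *v b) \<bullet> (Cvv *v (Rv *v b)) = 1"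
  proof -
    have "(Rv *v b) \<bullet> (Cvv *v (Rv *v b)) = (Rv *v b) \<bullet> (Sv *v b)"
      by (simp only: matrix_vector_mul_assoc cancel)
    also have "\<dots> = (Sv *v (Rv *v b)) \<bullet> b"
      by (simp only: inner_matrix_vector_right[of "Rv *v b" Sv b] sqrt_facts(2))
    finally show ?thesis
      by (simp only: matrix_vector_mul_assoc cancel matrix_vector_mul_lid bb)
  qed
  also have "?p \<bullet> (Cuv *v (Rv *v b)) = a \<bullet> ((Ru ** Cuv ** Rv) *v b)"
    by (simp add: inner_matrix_vector_right[of a Ru] sqrt_facts flip: matrix_vector_mul_assoc)
  finally show ?thesis by (simp add: ab)
qed simp

section \<open>Models with parameter \<open>coupling d\<close>\<close>

context
  fixes d :: "'u \<Rightarrow> real"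
  assumes d: "\<And>i. 0 \<le> d i" "\<And>i. d i < 1" "\<And>i. \<sigma> i = 0 \<Longrightarrow> d i = 0"
begin

lemma one_minus_d2: "1 - (d i)\<^sup>2 > 0"
  using d(1,2)[of i] by (simp add: abs_square_less_1)

text \<open>The Schur complement of the model's precision matrix, diagonalized by \<open>U\<close>
  up to whitening.\<close>

lemma precision_coupling:
  "matrix_inv Cuu - coupling d ** Cvv ** transpose (coupling d) =
    Ru ** U ** diag_mat (\<lambda>i. 1 - (d i)\<^sup>2) ** transpose U ** Ru"
proof -
  have "coupling d ** Cvv ** transpose (coupling d) =
      Ru ** (U ** (diag_mat d ** (transpose W ** (W ** (diag_mat d ** (transpose U ** Ru))))))"
    unfolding coupling_def
    by (simp add: matrix_transpose_mul transpose_diag_mat sqrt_facts(1-4) cancel matrix_mul_assoc[symmetric])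
  also have "\<dots> = Ru ** (U ** ((diag_mat d ** (transpose W ** W) ** diag_mat d) ** (transpose U ** Ru)))"
    by (simp only: matrix_mul_assoc)
  also have "diag_mat d ** (transpose W ** W) ** diag_mat d = diag_mat (\<lambda>i. (d i)\<^sup>2)"
    using d(3) by (subst W_gram) (auto simp: power2_eq_square)
  finally show ?thesis
    by (simp add: Cuu_inv cancel matrix_diff_ldistrib matrix_diff_rdistrib
        mat_1_minus_diag_mat[symmetric] matrix_mul_assoc[symmetric])
qed

lemma marginal_cov_mult_precision:
  "marginal_cov d ** (matrix_inv Cuu - coupling d ** Cvv ** transpose (coupling d)) = mat 1"
proof -
  have "diag_mat (\<lambda>i. 1 / (1 - (d i)\<^sup>2)) ** diag_mat (\<lambda>i. 1 - (d i)\<^sup>2) = mat 1"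
    using one_minus_d2 by (simp add: diag_mat_mult less_imp_neq[symmetric] diag_mat_1)
  note E = this[THEN matrix_mult_eq_assoc]
  show ?thesis
    unfolding precision_coupling marginal_cov_def
    by (simp add: E cancel matrix_mul_assoc[symmetric])
qed

lemma pos_def_marginal_cov: "pos_def (marginal_cov d)"
proof -
  have "invertible (Su ** U)"
    using U_facts by (intro invertible_mult pos_def_invertible[OF pos_def_mat_sqrt[OF pd(1)]])
      (auto simp: invertible_def)
  moreover have "pos_def (diag_mat (\<lambda>i. 1 / (1 - (d i)\<^sup>2)))"
    using one_minus_d2 by (intro pos_def_diag_mat) simp
  ultimately have "pos_def ((Su ** U) ** diag_mat (\<lambda>i. 1 / (1 - (d i)\<^sup>2)) ** transpose (Su ** U))"
    by (intro pos_def_congruence)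
  then show ?thesis
    by (simp add: marginal_cov_def matrix_transpose_mul sqrt_facts matrix_mul_assoc)
qed

text \<open>The left-hand side is the model's cross-covariance from the block inverse. Equating it
  with \<open>Cuv\<close> leads to \<open>d i / (1 - (d i)\<^sup>2) = \<sigma> i\<close>, the
  equation solved by \<open>h\<close>.\<close>

lemma marginal_cov_coupling:
  "marginal_cov d ** coupling d ** Cvv =
    Su ** U ** diag_mat (\<lambda>i. d i / (1 - (d i)\<^sup>2)) ** transpose W ** Sv"
proof -
  have e: "diag_mat (\<lambda>i. d i / (1 - (d i)\<^sup>2)) = diag_mat (\<lambda>i. 1 / (1 - (d i)\<^sup>2)) ** diag_mat d"
    by (simp add: diag_mat_mult)
  show ?thesis
    unfolding e marginal_cov_def coupling_def
    by (simp add: cancel matrix_mul_assoc[symmetric])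
qed

text \<open>Only the upper blocks are made explicit: the first gives the u-marginal, the second
  enters the moment condition.\<close>

lemma model_coupling:
  obtains Gvu Gvv where
    "pos_def (block_matrix (marginal_cov d) (marginal_cov d ** coupling d ** Cvv) Gvu Gvv)"
    "model \<mu> (coupling d) = gaussian_prod (block_matrix (marginal_cov d) (marginal_cov d ** coupling d ** Cvv) Gvu Gvv)"
    "exp_moment \<mu> (coupling d) \<noteq> 0" "exp_moment \<mu> (coupling d) \<noteq> \<infinity>"
proof -
  note P = pos_def_precision[OF pd(1,2) pos_def_marginal_cov marginal_cov_mult_precision]
  note m = exp_moment_finite[OF pd(1,2) P(1) marginal_u_gaussian_prod[OF C] marginal_v_gaussian_prod[OF C]]
    model_eq_gaussian_prod[OF pd(1,2) P(1) marginal_u_gaussian_prod[OF C] marginal_v_gaussian_prod[OF C]]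
  show thesis
    by (rule that[OF pos_def_matrix_inv[OF P(1), unfolded P(2)] m(3)[unfolded P(2)] m(1,2)])
qed

lemma marginal_u_model_coupling: "marginal_u (model \<mu> (coupling d)) = gaussian (marginal_cov d)"
  by (rule model_coupling) (simp add: marginal_u_gaussian_prod)

lemma marginal_cov_alt:
  "marginal_cov d = Su ** U ** matrix_inv (mat 1 - diag_mat d ** diag_mat d) ** transpose U ** Su"
  using one_minus_d2 unfolding marginal_cov_def diag_mat_mult mat_1_minus_diag_mat
  by (subst matrix_inv_diag_mat) (simp_all add: power2_eq_square less_imp_neq[symmetric])

end

text \<open>The variance in direction \<open>x\<close> is a weighted sum over singular directions,
  so covariances with different \<open>d\<close> can be compared weight by weight.\<close>

lemma marginal_cov_quadratic_form:
  "x \<bullet> (marginal_cov d *v x) = (\<Sum>i\<in>UNIV. 1 / (1 - (d i)\<^sup>2) * ((transpose U *v (Su *v x)) $ i)\<^sup>2)"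
proof -
  let ?y = "transpose U *v (Su *v x)"
  have "x \<bullet> (marginal_cov d *v x) = ?y \<bullet> (diag_mat (\<lambda>i. 1 / (1 - (d i)\<^sup>2)) *v ?y)"
    by (simp add: marginal_cov_def inner_matrix_vector_right[of x Su] inner_matrix_vector_right[of _ U] sqrt_facts
        flip: matrix_vector_mul_assoc)
  then show ?thesis
    by (simp add: inner_vec_def diag_mat_mult_vec power2_eq_square ac_simps)
qed

lemma marginal_cov_0: "marginal_cov (\<lambda>_. 0) = Cuu"
  by (simp add: marginal_cov_def diag_mat_1 cancel sqrt_facts matrix_mul_assoc[symmetric])

text \<open>\<open>Cvu *v x\<close> depends on \<open>x\<close> only through the components weighted
  by \<open>\<sigma>\<close>, so one of these survives; it yields the strict summand in the
  comparison of variances.\<close>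

lemma singular_component_nonzero:
  assumes "Cvu *v x \<noteq> 0"
  shows "\<exists>i. \<sigma> i \<noteq> 0 \<and> (transpose U *v (Su *v x)) $ i \<noteq> 0"
proof (rule ccontr)
  assume "\<not> ?thesis"
  then have "diag_mat \<sigma> *v (transpose U *v (Su *v x)) = 0"
    by (auto simp: vec_eq_iff diag_mat_mult_vec)
  moreover have "Cvu *v x = Sv *v (W *v (diag_mat \<sigma> *v (transpose U *v (Su *v x))))"
    unfolding pd(3) by (subst Cuv_eq)
      (simp add: matrix_transpose_mul transpose_diag_mat sqrt_facts matrix_mul_assoc flip: matrix_vector_mul_assoc)
  ultimately show False using assms by simp
qed

lemma cond_loss_minimizer: "A \<noteq> coupling \<sigma> \<Longrightarrow> cond_loss \<mu> (coupling \<sigma>) < cond_loss \<mu> A"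
proof (rule cond_loss_less[OF refl C])
  show "Cuu ** coupling \<sigma> ** Cvv = Cuv"
    by (subst Cuv_eq) (simp add: coupling_def cancel matrix_mul_assoc[symmetric])
qed

lemma h_\<sigma>: "0 \<le> h (\<sigma> i)" "h (\<sigma> i) < 1" "\<sigma> i = 0 \<Longrightarrow> h (\<sigma> i) = 0" "h (\<sigma> i) \<le> \<sigma> i"
  "h (\<sigma> i) / (1 - (h (\<sigma> i))\<^sup>2) = \<sigma> i"
proof -
  have pos: "0 < h (\<sigma> i) \<and> h (\<sigma> i) < \<sigma> i \<and> h (\<sigma> i) = \<sigma> i * (1 - (h (\<sigma> i))\<^sup>2)" if "\<sigma> i \<noteq> 0"
    using h_properties[of "\<sigma> i"] \<sigma>_nonneg[of i] that by simp
  show "\<sigma> i = 0 \<Longrightarrow> h (\<sigma> i) = 0" by simp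
  show nn: "0 \<le> h (\<sigma> i)" and le: "h (\<sigma> i) \<le> \<sigma> i"
    using pos by (cases "\<sigma> i = 0"; simp)+
  show l1: "h (\<sigma> i) < 1" using le \<sigma>_less_1[of i] by linarith
  have "1 - (h (\<sigma> i))\<^sup>2 > 0" using nn l1 by (simp add: abs_square_less_1)
  then show "h (\<sigma> i) / (1 - (h (\<sigma> i))\<^sup>2) = \<sigma> i"
    using pos by (cases "\<sigma> i = 0") (simp_all add: divide_eq_eq)
qed

lemma joint_loss_minimizer:
  assumes "A \<noteq> coupling (\<lambda>i. h (\<sigma> i))"
  shows "joint_loss \<mu> (coupling (\<lambda>i. h (\<sigma> i))) < joint_loss \<mu> A"
proof -
  let ?d = "\<lambda>i. h (\<sigma> i)"
  \<comment> \<open>Here \<open>d i / (1 - (d i)\<^sup>2)\<close> is \<open>\<sigma> i\<close>, so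
    the singular value decomposition of \<open>Cuv\<close> reappears.\<close>
  have cross: "marginal_cov ?d ** coupling ?d ** Cvv = Cuv"
    by (subst marginal_cov_coupling) (simp_all add: h_\<sigma> flip: Cuv_eq)
  obtain Gvu Gvv where
    "pos_def (block_matrix (marginal_cov ?d) Cuv Gvu Gvv)"
    "model \<mu> (coupling ?d) = gaussian_prod (block_matrix (marginal_cov ?d) Cuv Gvu Gvv)"
    "exp_moment \<mu> (coupling ?d) \<noteq> 0" "exp_moment \<mu> (coupling ?d) \<noteq> \<infinity>"
    using model_coupling[of ?d, unfolded cross] h_\<sigma> by metis
  then show ?thesis
    using assms by (intro joint_loss_less[OF refl C])
qed

lemma marginal_cov_mono:
  assumes "\<And>i. 0 \<le> d i" "\<And>i. d i \<le> e i" "\<And>i. e i < 1"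
  shows "x \<bullet> (marginal_cov d *v x) \<le> x \<bullet> (marginal_cov e *v x)"
    and "\<lbrakk>\<And>i. \<sigma> i \<noteq> 0 \<Longrightarrow> d i < e i; Cvu *v x \<noteq> 0\<rbrakk> \<Longrightarrow>
      x \<bullet> (marginal_cov d *v x) < x \<bullet> (marginal_cov e *v x)"
proof -
  show "x \<bullet> (marginal_cov d *v x) \<le> x \<bullet> (marginal_cov e *v x)"
    unfolding marginal_cov_quadratic_form
    by (intro sum_mono mult_right_mono weight_mono assms) auto
  assume less: "\<And>i. \<sigma> i \<noteq> 0 \<Longrightarrow> d i < e i" and "Cvu *v x \<noteq> 0"
  then obtain i where i: "\<sigma> i \<noteq> 0" "(transpose U *v (Su *v x)) $ i \<noteq> 0"
    using singular_component_nonzero by blast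
  show "x \<bullet> (marginal_cov d *v x) < x \<bullet> (marginal_cov e *v x)"
    unfolding marginal_cov_quadratic_form
  proof (rule sum_strict_mono_ex1)
    show "\<exists>i\<in>UNIV. 1 / (1 - (d i)\<^sup>2) * ((transpose U *v (Su *v x)) $ i)\<^sup>2
        < 1 / (1 - (e i)\<^sup>2) * ((transpose U *v (Su *v x)) $ i)\<^sup>2"
      using i less assms by (intro bexI[of _ i] mult_strict_right_mono weight_mono(2)) auto
  qed (simp, intro ballI mult_right_mono weight_mono(1) assms zero_le_power2)
qed

end

text \<open>A strict inequality against every competitor gives existence and uniqueness of the
  minimizer at once.\<close>

lemma is_arg_min_iff_strict:
  assumes "\<And>A. A \<noteq> A0 \<Longrightarrow> f A0 < (f A :: 'b::preorder)"
  shows "is_arg_min f (\<lambda>_. True) A \<longleftrightarrow> A = A0"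
  using assms unfolding is_arg_min_def by (metis less_asym)

text \<open>Closeness to the true marginal is expressed by variances in every direction
  \<open>x\<close>. Since \<open>Cvu *v x\<close> is the covariance of \<open>v\<close> with
  \<open>x \<bullet> u\<close>, the order is strict whenever \<open>x \<bullet> u\<close> is
  correlated with \<open>v\<close>.\<close>

theorem corollary5p7:
  fixes Cuu :: "real^'u::finite^'u" and Cuv :: "real^'v::finite^'u"
    and Cvu :: "real^'u^'v" and Cvv :: "real^'v^'v"
    and \<mu> :: "((real^'u) \<times> (real^'v)) measure"
    and U \<Sigma> :: "real^'u^'u"
  assumes C: "pos_def (block_matrix Cuu Cuv Cvu Cvv)"
    and \<mu>: "\<mu> = gaussian_prod (block_matrix Cuu Cuv Cvu Cvv)"
    and svd: "left_svd (matrix_inv (mat_sqrt Cuu) ** Cuv ** matrix_inv (mat_sqrt Cvv)) U \<Sigma>"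
  shows "marginal_u \<mu> = gaussian Cuu \<and> marginal_v \<mu> = gaussian Cvv \<and>
    (\<exists>A_cond A_joint.
      (\<forall>A. is_arg_min (cond_loss \<mu>) (\<lambda>_. True) A \<longleftrightarrow> A = A_cond) \<and>
      (\<forall>A. is_arg_min (joint_loss \<mu>) (\<lambda>_. True) A \<longleftrightarrow> A = A_joint) \<and>
      marginal_u (model \<mu> A_cond) =
        gaussian (mat_sqrt Cuu ** U ** matrix_inv (mat 1 - \<Sigma> ** \<Sigma>)
                  ** transpose U ** mat_sqrt Cuu) \<and>
      marginal_u (model \<mu> A_joint) =
        gaussian (mat_sqrt Cuu ** U ** matrix_inv (mat 1 - h_diag \<Sigma> ** h_diag \<Sigma>)
                  ** transpose U ** mat_sqrt Cuu) \<and>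
      (\<forall>x. let var_true = x \<bullet> (cov_matrix (marginal_u \<mu>) *v x);
               var_joint = x \<bullet> (cov_matrix (marginal_u (model \<mu> A_joint)) *v x);
               var_cond = x \<bullet> (cov_matrix (marginal_u (model \<mu> A_cond)) *v x)
           in var_true \<le> var_joint \<and> var_joint \<le> var_cond \<and>
              (Cvu *v x \<noteq> 0 \<longrightarrow> var_true < var_joint \<and> var_joint < var_cond)))"
proof -
  define \<sigma> where "\<sigma> i = \<Sigma> $ i $ i" for i
  have \<Sigma>: "\<Sigma> = diag_mat \<sigma>"
    using svd by (auto simp: left_svd_def \<sigma>_def vec_eq_iff diag_mat_nth)
  have h\<Sigma>: "h_diag \<Sigma> = diag_mat (\<lambda>i. h (\<sigma> i))"
    by (simp add: h_diag_def \<sigma>_def diag_mat_def)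
  have "\<exists>W :: real^'u^'v.
      matrix_inv (mat_sqrt Cuu) ** Cuv ** matrix_inv (mat_sqrt Cvv) = U ** \<Sigma> ** transpose W \<and>
      (\<forall>i j. \<sigma> i \<noteq> 0 \<and> \<sigma> j \<noteq> 0 \<longrightarrow> column i W \<bullet> column j W = (if i = j then 1 else 0))"
    using svd unfolding left_svd_def \<sigma>_def by (elim conjE)
  then obtain W :: "real^'u^'v" where
    W: "matrix_inv (mat_sqrt Cuu) ** Cuv ** matrix_inv (mat_sqrt Cvv) = U ** \<Sigma> ** transpose W"
      "\<forall>i j. \<sigma> i \<noteq> 0 \<and> \<sigma> j \<noteq> 0 \<longrightarrow> column i W \<bullet> column j W = (if i = j then 1 else 0)"
    by blast
  interpret gaussian_svd Cuu Cuv Cvu Cvv U \<sigma> W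
  proof unfold_locales
    show "0 \<le> \<sigma> i" for i using svd by (simp add: left_svd_def \<sigma>_def)
    show "orthogonal_matrix U" using svd by (simp add: left_svd_def)
  qed (use W in \<open>simp_all add: C flip: \<Sigma>\<close>)
  let ?hs = "\<lambda>i. h (\<sigma> i)"
  \<comment> \<open>The trivial last clause gives the premises the shape of the assumptions on
    \<open>d\<close>.\<close>
  have \<sigma>0: "0 \<le> \<sigma> i" "\<sigma> i < 1" "\<sigma> i = 0 \<Longrightarrow> \<sigma> i = 0" for i
    by (simp_all add: \<sigma>_nonneg \<sigma>_less_1)
  have cond: "marginal_u (model \<mu> (coupling \<sigma>)) = gaussian (marginal_cov \<sigma>)"
    unfolding \<mu> by (rule marginal_u_model_coupling[OF \<sigma>0])
  have joint: "marginal_u (model \<mu> (coupling ?hs)) = gaussian (marginal_cov ?hs)"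
    unfolding \<mu> by (rule marginal_u_model_coupling[OF h_\<sigma>(1-3)])
  have cov: "cov_matrix (marginal_u (model \<mu> (coupling \<sigma>))) = marginal_cov \<sigma>"
    "cov_matrix (marginal_u (model \<mu> (coupling ?hs))) = marginal_cov ?hs"
    using pos_def_marginal_cov[OF \<sigma>0] pos_def_marginal_cov[OF h_\<sigma>(1-3)]
    by (simp_all only: cond joint cov_matrix_gaussian)
  have true: "marginal_u \<mu> = gaussian Cuu" "marginal_v \<mu> = gaussian Cvv"
    unfolding \<mu> by (rule marginal_u_gaussian_prod[OF C], rule marginal_v_gaussian_prod[OF C])
  \<comment> \<open>With the true covariance as the case \<open>d = 0\<close>, both comparisons are
    instances of \<open>marginal_cov_mono\<close>.\<close>
  have cov_true: "cov_matrix (marginal_u \<mu>) = marginal_cov (\<lambda>_. 0)"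
    unfolding true marginal_cov_0 by (rule cov_matrix_gaussian[OF pd(1)])
  have strict: "\<sigma> i \<noteq> 0 \<Longrightarrow> 0 < ?hs i" "\<sigma> i \<noteq> 0 \<Longrightarrow> ?hs i < \<sigma> i" for i
    using h_properties[of "\<sigma> i"] \<sigma>_nonneg[of i] by auto
  have var: "x \<bullet> (marginal_cov (\<lambda>_. 0) *v x) \<le> x \<bullet> (marginal_cov ?hs *v x) \<and>
      x \<bullet> (marginal_cov ?hs *v x) \<le> x \<bullet> (marginal_cov \<sigma> *v x) \<and>
      (Cvu *v x \<noteq> 0 \<longrightarrow> x \<bullet> (marginal_cov (\<lambda>_. 0) *v x) < x \<bullet> (marginal_cov ?hs *v x) \<and>
        x \<bullet> (marginal_cov ?hs *v x) < x \<bullet> (marginal_cov \<sigma> *v x))" for x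
    using marginal_cov_mono[of "\<lambda>_. 0" ?hs x] marginal_cov_mono[of ?hs \<sigma> x] strict h_\<sigma> \<sigma>_less_1 by auto
  show ?thesis
  proof (rule conjI[OF true(1) conjI[OF true(2)]], rule exI[of _ "coupling \<sigma>"],
      rule exI[of _ "coupling ?hs"], intro conjI allI)
    show "is_arg_min (cond_loss \<mu>) (\<lambda>_. True) A \<longleftrightarrow> A = coupling \<sigma>" for A
      unfolding \<mu> by (rule is_arg_min_iff_strict) (rule cond_loss_minimizer)
    show "is_arg_min (joint_loss \<mu>) (\<lambda>_. True) A \<longleftrightarrow> A = coupling ?hs" for A
      unfolding \<mu> by (rule is_arg_min_iff_strict) (rule joint_loss_minimizer)
    show "marginal_u (model \<mu> (coupling \<sigma>)) =
        gaussian (mat_sqrt Cuu ** U ** matrix_inv (mat 1 - \<Sigma> ** \<Sigma>) ** transpose U ** mat_sqrt Cuu)"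
      unfolding cond \<Sigma> by (subst marginal_cov_alt[OF \<sigma>0]) simp_all
    show "marginal_u (model \<mu> (coupling ?hs)) =
        gaussian (mat_sqrt Cuu ** U ** matrix_inv (mat 1 - h_diag \<Sigma> ** h_diag \<Sigma>) ** transpose U ** mat_sqrt Cuu)"
      unfolding joint h\<Sigma> by (subst marginal_cov_alt[OF h_\<sigma>(1-3)]) simp_all
  qed (unfold Let_def cov cov_true, rule var)
qed

end
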